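(* Let $(U_1,U_2)$ be a continuous unitary sewing system with values in $U(n)$, $A$ a continuous equivariant cocycle over $Sw=w+\tau$, and let $L$ be a continuous invariant line, of arbitrary charge, carrying a nonzero measurable eigensection $F_0$ with eigenvalue $\lambda_0$. Then: (1) for every $\nu\in\mathbb Z^2$, $F_\nu:=\mathrm e^{2\pi\mathrm i\nu\cdot w}F_0$ is an eigensection carried by $L$ with eigenvalue $\lambda_\nu:=\lambda_0\mathrm e^{-2\pi\mathrm i\nu\cdot\tau}$; (2) if in addition $n=2$, $(U_1,U_2,A)$ is strip-admissible and admits a dominated splitting $E^s\oplus E^u$, $\tau\in\mathrm{DC}(c,\nu)$ for some $c>0,\nu\geq 1$, $L\in\{E^s,E^u\}$, $m(L)=0$, $k(L)=0$, and $F_0,\lambda_0$ are the explicit eigensection and eigenvalue described in the context, then conversely every nonzero measurable eigensection $F$ carried by the line field of $L$, with eigenvalue $\lambda$, satisfies $\lambda=\lambda_\nu$ and $F=cF_\nu$ a.e. for a unique $\nu\in\mathbb Z^2$ and some constant $c\ne0$. Under the hypotheses of part (2), the set of eigenvalues realised on $L$ is the coset $\Lambda_L=\lambda_0\{\mathrm e^{-2\pi\mathrm i\nu\cdot\tau}:\nu\in\mathbb Z^2\}$, a dense subset of the circle $|\lambda|=\mathrm e^{\lambda_L}$; each is geometrically simple within $L$, i.e. the space of measurable eigensections (together with $0$) carried by $L$ at that eigenvalue is one-dimensional; and every measurable eigensection carried by $L$ agrees a.e. with a real-analytic nowhere-vanishing one.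
   Context: Notation. $\mathbb T^2=\mathbb R^2/\mathbb Z^2$, $w=(w_1,w_2)$, Haar probability measure $\mu$; $e_1=(1,0)$, $e_2=(0,1)$; $\langle h\rangle=\int_{\mathbb T^2}h\,d\mu$; the inner product on $\mathbb C^n$ is conjugate-linear in the first slot; $\tau=(\alpha,\beta)\in\mathbb R^2$, $Sw=w+\tau$. Sewing system and cocycle. A continuous unitary sewing system is a pair of continuous $U_1,U_2\colon\mathbb R^2\to U(n)$ with (K1) $U_1(w+e_2)U_2(w)=U_2(w+e_1)U_1(w)$; it presents the Hermitian bundle $V\to\mathbb T^2$ given as the quotient of $\mathbb R^2\times\mathbb C^n$ by the action generated by $(w,\xi)\mapsto(w+e_j,U_j(w)\xi)$. Measurable sections of $V$ are measurable $F\colon\mathbb R^2\to\mathbb C^n$ with $F(w+e_j)=U_j(w)F(w)$ a.e. A continuous equivariant cocycle is a continuous $A\colon\mathbb R^2\to GL(n,\mathbb C)$ with (K2) $A(w+e_j)U_j(w)=U_j(Sw)A(w)$. A measurable eigensection with eigenvalue $\lambda\in\mathbb C$ is a measurable section, not a.e. zero, with $A(w)F(w)=\lambda F(Sw)$ a.e. Invariant line. A continuous map $\ell$ from $\mathbb R^2$ to the projective space of $\mathbb C^n$ with $\ell(w+e_j)=U_j(w)\ell(w)$ and $A(w)\ell(w)=\ell(Sw)$ for all $w$; it induces a line subbundle $L\subset V$ with line field $\ell$. $F$ is carried by $L$ if $F(w)\in\ell(w)$ a.e. An eigenvalue is realised on $L$ if it has a measurable eigensection carried by $L$. Charge and multiplier.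 There are a continuous $e\colon\mathbb R^2\to\mathbb C^n$ with $|e|=1$, $e(w)\in\ell(w)$, and a unique integer $m=m(L)$ (the charge) with $e(w+e_1)=U_1(w)e(w)$, $e(w+e_2)=\mathrm e^{2\pi\mathrm i m w_1}U_2(w)e(w)$; $e$ is a normalized unit section. The multiplier is $q(w)=\langle e(Sw),A(w)e(w)\rangle$ (continuous, zero-free); $p(w)=\frac{q(w)}{|q(w)|}\mathrm e^{2\pi\mathrm i m\alpha w_2}$ is continuous, $\mathbb Z^2$-periodic, unimodular; $k=k(L)\in\mathbb Z^2$ is its winding vector and $g\colon\mathbb T^2\to\mathbb R$ is continuous with $p(w)=\mathrm e^{2\pi\mathrm i(k\cdot w+g(w))}$. $\lambda_L=\langle\log|q|\rangle$ is the Lyapunov exponent of $L$. Strip-admissible ($n=2$). For $\delta>0$ let $\Omega_\delta=\{w\in\mathbb C^2:|\operatorname{Im}w_1|\le\delta,|\operatorname{Im}w_2|\le\delta\}$. $(U_1,U_2,A)$ is strip-admissible if for some $\delta_0>0$ the maps $U_1,U_2,A$ extend to matrix functions holomorphic on an open neighborhood of $\Omega_{\delta_0}$ and bounded on $\Omega_{\delta_0}$, with $U_j(w)$ unitary and $\det A(w)\ne0$ for real $w$, and (K1), (K2) holding on $\mathbb R^2$. Dominated splitting ($n=2$). A pair of invariant lines $\ell_s,\ell_u$ with $\ell_s(w)\ne\ell_u(w)$ for all $w$, inducing $E^s,E^u$ with $V=E^s\oplus E^u$, such that for some integer $N\ge1$ and $0<\kappa_0<1$, $\|A^{(N)}(z)|_{\ell_s(z)}\|/\mathfrak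 m(A^{(N)}(z)|_{\ell_u(z)})\le\kappa_0^2$ for all $z\in\mathbb R^2$, where $A^{(N)}(w)=A(S^{N-1}w)\cdots A(w)$ and $\mathfrak m(M)=\min_{|v|=1}|Mv|$. Diophantine condition. $\tau\in\mathrm{DC}(c,\nu)$, $c>0,\nu\ge1$, means $\|\nu_1'\alpha+\nu_2'\beta\|_{\mathbb R/\mathbb Z}\ge c\,(|\nu_1'|+|\nu_2'|)^{-\nu}$ for all $(\nu_1',\nu_2')\in\mathbb Z^2\setminus\{0\}$ (distance to the nearest integer). The explicit $F_0,\lambda_0$ in part (2). Under the hypotheses of part (2), the line field of $L$ has a real-analytic normalized unit section $e_{\mathrm{an}}$, for which $\log|q|$ and $g$ are real analytic on $\mathbb T^2$, and there are real-analytic $v_1,v_2\colon\mathbb T^2\to\mathbb R$ with $v_1-v_1\circ S=\log|q|-\langle\log|q|\rangle$ and $v_2-v_2\circ S=g-\langle g\rangle$. Put $F_0=\mathrm e^{-(v_1+2\pi\mathrm i v_2)}e_{\mathrm{an}}$ and $\lambda_0=\exp(\langle\log|q|\rangle)\exp(2\pi\mathrm i\langle g\rangle)$; $F_0$ is a measurable eigensection carried by $L$ with eigenvalue $\lambda_0$. *)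

theory Defs
  imports "HOL-Analysis.Analysis"
begin

text \<open>
  Functions on the torus are rendered as functions on \<open>real ^ 2\<close> that are periodic under
  the two unit translations \<open>axis j 1\<close>, and the translation of the torus is
  \<open>w \<mapsto> w + \<tau>\<close>. The pair of sewing maps is indexed by the two-element type \<open>2\<close>, with
  \<open>U 1\<close> and \<open>U 2\<close> its members (and \<open>w $ 1\<close>, \<open>w $ 2\<close> the coordinates). The norm of
  \<open>complex ^ 'n\<close> is the Hermitian one.
\<close>

subsection \<open>Linear algebra\<close>

definition hinner :: "complex ^ 'n \<Rightarrow> complex ^ 'n \<Rightarrow> complex" where
  "hinner v w = (\<Sum>i\<in>UNIV. cnj (v $ i) * w $ i)"

definition conj_transpose :: "complex ^ 'n ^ 'n \<Rightarrow> complex ^ 'n ^ 'n" where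
  "conj_transpose M = (\<chi> i j. cnj (M $ j $ i))"

definition unitary :: "complex ^ 'n ^ 'n \<Rightarrow> bool" where
  "unitary M \<longleftrightarrow> conj_transpose M ** M = mat 1 \<and> M ** conj_transpose M = mat 1"

definition e2pi :: "real \<Rightarrow> complex" where
  "e2pi x = exp (2 * of_real pi * \<i> * of_real x)"

definition zdot :: "int ^ 2 \<Rightarrow> real ^ 2 \<Rightarrow> real" where
  "zdot \<nu> w = (\<Sum>i\<in>UNIV. of_int (\<nu> $ i) * w $ i)"

subsection \<open>Projective space\<close>

definition lines :: "(complex ^ 'n) set set" where
  "lines = {L. vec.subspace L \<and> vec.dim L = 1}"

text \<open>The quotient topology of \<open>v \<mapsto> vec.span {v}\<close> on the nonzero vectors.\<close>

definition projective_space :: "(complex ^ 'n) set topology" where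
  "projective_space = topology (\<lambda>T. T \<subseteq> lines \<and> open {v. v \<noteq> 0 \<and> vec.span {v} \<in> T})"

lemma openin_projective_space:
  fixes T :: "(complex ^ 'n) set set"
  shows "openin projective_space T \<longleftrightarrow> T \<subseteq> lines \<and> open {v. v \<noteq> 0 \<and> vec.span {v} \<in> T}"
proof -
  have "istopology (\<lambda>T. T \<subseteq> lines \<and> open {v::complex ^ 'n. v \<noteq> 0 \<and> vec.span {v} \<in> T})"
    unfolding istopology_def
  proof (intro conjI allI impI)
    fix S T :: "(complex ^ 'n) set set"
    assume S: "S \<subseteq> lines \<and> open {v. v \<noteq> 0 \<and> vec.span {v} \<in> S}"
      and T: "T \<subseteq> lines \<and> open {v. v \<noteq> 0 \<and> vec.span {v} \<in> T}"
    have "{v. v \<noteq> 0 \<and> vec.span {v} \<in> S \<inter> T}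
        = {v. v \<noteq> 0 \<and> vec.span {v} \<in> S} \<inter> {v. v \<noteq> 0 \<and> vec.span {v} \<in> T}" by auto
    then show "open {v. v \<noteq> 0 \<and> vec.span {v} \<in> S \<inter> T}" using S T by (simp add: open_Int)
    show "S \<inter> T \<subseteq> lines" using S by blast
  next
    fix K :: "(complex ^ 'n) set set set"
    assume K: "\<forall>S\<in>K. S \<subseteq> lines \<and> open {v. v \<noteq> 0 \<and> vec.span {v} \<in> S}"
    have "{v. v \<noteq> 0 \<and> vec.span {v} \<in> \<Union>K} = (\<Union>S\<in>K. {v. v \<noteq> 0 \<and> vec.span {v} \<in> S})" by auto
    then show "open {v. v \<noteq> 0 \<and> vec.span {v} \<in> \<Union>K}" using K by auto
    show "\<Union>K \<subseteq> lines" using K by blast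
  qed
  then show ?thesis by (simp add: projective_space_def topology_inverse')
qed

lemma topspace_projective_space: "topspace projective_space = (lines :: (complex ^ 'n) set set)"
proof -
  have "{v::complex ^ 'n. v \<noteq> 0 \<and> vec.span {v} \<in> lines} = - {0}"
    by (auto simp: lines_def vec.subspace_span)
  then have "openin projective_space (lines :: (complex ^ 'n) set set)"
    by (simp add: openin_projective_space open_Compl)
  then show ?thesis
    by (meson openin_projective_space openin_subset openin_topspace subset_antisym)
qed

subsection \<open>Sewing systems, cocycles and eigensections\<close>

definition sewing_system :: "(2 \<Rightarrow> real ^ 2 \<Rightarrow> complex ^ 'n ^ 'n) \<Rightarrow> bool" where
  "sewing_system U \<longleftrightarrow>
     (\<forall>j. continuous_on UNIV (U j)) \<and>
     (\<forall>j w. unitary (U j w)) \<and>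
     (\<forall>w. U 1 (w + axis 2 1) ** U 2 w = U 2 (w + axis 1 1) ** U 1 w)"

definition equivariant_cocycle ::
  "(2 \<Rightarrow> real ^ 2 \<Rightarrow> complex ^ 'n ^ 'n) \<Rightarrow> (real ^ 2 \<Rightarrow> complex ^ 'n ^ 'n) \<Rightarrow> real ^ 2 \<Rightarrow> bool" where
  "equivariant_cocycle U A \<tau> \<longleftrightarrow>
     continuous_on UNIV A \<and>
     (\<forall>w. invertible (A w)) \<and>
     (\<forall>j w. A (w + axis j 1) ** U j w = U j (w + \<tau>) ** A w)"

definition measurable_section ::
  "(2 \<Rightarrow> real ^ 2 \<Rightarrow> complex ^ 'n ^ 'n) \<Rightarrow> (real ^ 2 \<Rightarrow> complex ^ 'n) \<Rightarrow> bool" where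
  "measurable_section U F \<longleftrightarrow>
     F \<in> borel_measurable lebesgue \<and>
     (\<forall>j. AE w in lebesgue. F (w + axis j 1) = U j w *v F w)"

definition eigensection ::
  "(2 \<Rightarrow> real ^ 2 \<Rightarrow> complex ^ 'n ^ 'n) \<Rightarrow> (real ^ 2 \<Rightarrow> complex ^ 'n ^ 'n) \<Rightarrow> real ^ 2 \<Rightarrow>
   (real ^ 2 \<Rightarrow> complex ^ 'n) \<Rightarrow> complex \<Rightarrow> bool" where
  "eigensection U A \<tau> F \<eta> \<longleftrightarrow>
     measurable_section U F \<and>
     \<not> (AE w in lebesgue. F w = 0) \<and>
     (AE w in lebesgue. A w *v F w = \<eta> *s F (w + \<tau>))"

definition invariant_line ::
  "(2 \<Rightarrow> real ^ 2 \<Rightarrow> complex ^ 'n ^ 'n) \<Rightarrow> (real ^ 2 \<Rightarrow> complex ^ 'n ^ 'n) \<Rightarrow> real ^ 2 \<Rightarrow>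
   (real ^ 2 \<Rightarrow> (complex ^ 'n) set) \<Rightarrow> bool" where
  "invariant_line U A \<tau> l \<longleftrightarrow>
     continuous_map euclidean projective_space l \<and>
     (\<forall>j w. l (w + axis j 1) = (\<lambda>v. U j w *v v) ` l w) \<and>
     (\<forall>w. (\<lambda>v. A w *v v) ` l w = l (w + \<tau>))"

definition carried_by :: "(real ^ 2 \<Rightarrow> (complex ^ 'n) set) \<Rightarrow> (real ^ 2 \<Rightarrow> complex ^ 'n) \<Rightarrow> bool" where
  "carried_by l F \<longleftrightarrow> (AE w in lebesgue. F w \<in> l w)"

definition realised_eigenvalues ::
  "(2 \<Rightarrow> real ^ 2 \<Rightarrow> complex ^ 'n ^ 'n) \<Rightarrow> (real ^ 2 \<Rightarrow> complex ^ 'n ^ 'n) \<Rightarrow> real ^ 2 \<Rightarrow>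
   (real ^ 2 \<Rightarrow> (complex ^ 'n) set) \<Rightarrow> complex set" where
  "realised_eigenvalues U A \<tau> l = {\<eta>. \<exists>F. eigensection U A \<tau> F \<eta> \<and> carried_by l F}"

text \<open>The eigensections at \<open>\<eta>\<close> carried by the line, together with the a.e. zero sections.\<close>

definition line_eigenspace ::
  "(2 \<Rightarrow> real ^ 2 \<Rightarrow> complex ^ 'n ^ 'n) \<Rightarrow> (real ^ 2 \<Rightarrow> complex ^ 'n ^ 'n) \<Rightarrow> real ^ 2 \<Rightarrow>
   (real ^ 2 \<Rightarrow> (complex ^ 'n) set) \<Rightarrow> complex \<Rightarrow> (real ^ 2 \<Rightarrow> complex ^ 'n) set" where
  "line_eigenspace U A \<tau> l \<eta> =
     {F. measurable_section U F \<and> carried_by l F \<and>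
         (AE w in lebesgue. A w *v F w = \<eta> *s F (w + \<tau>))}"

text \<open>One-dimensionality over \<open>complex\<close> after identifying a.e. equal functions.\<close>

definition ae_one_dimensional :: "(real ^ 2 \<Rightarrow> complex ^ 'n) set \<Rightarrow> bool" where
  "ae_one_dimensional E \<longleftrightarrow>
     (\<exists>F\<in>E. \<not> (AE w in lebesgue. F w = 0) \<and>
        E = {G \<in> borel_measurable lebesgue. \<exists>c. AE w in lebesgue. G w = c *s F w})"

subsection \<open>Charge, multiplier, winding and Lyapunov exponent of an invariant line\<close>

definition torus_periodic :: "(real ^ 2 \<Rightarrow> 'a) \<Rightarrow> bool" where
  "torus_periodic h \<longleftrightarrow> (\<forall>j w. h (w + axis j 1) = h w)"

definition torus_mean :: "(real ^ 2 \<Rightarrow> real) \<Rightarrow> real" where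
  "torus_mean h = (LINT w:cbox 0 1|lebesgue. h w)"

definition unit_section_charge ::
  "(2 \<Rightarrow> real ^ 2 \<Rightarrow> complex ^ 'n ^ 'n) \<Rightarrow> (real ^ 2 \<Rightarrow> (complex ^ 'n) set) \<Rightarrow>
   int \<Rightarrow> (real ^ 2 \<Rightarrow> complex ^ 'n) \<Rightarrow> bool" where
  "unit_section_charge U l m e \<longleftrightarrow>
     continuous_on UNIV e \<and>
     (\<forall>w. norm (e w) = 1 \<and> e w \<in> l w) \<and>
     (\<forall>w. e (w + axis 1 1) = U 1 w *v e w) \<and>
     (\<forall>w. e (w + axis 2 1) = e2pi (of_int m * w $ 1) *s (U 2 w *v e w))"

text \<open>Every line invariant under the sewing maps has such a section, for exactly one \<open>m\<close>.\<close>

definition charge ::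
  "(2 \<Rightarrow> real ^ 2 \<Rightarrow> complex ^ 'n ^ 'n) \<Rightarrow> (real ^ 2 \<Rightarrow> (complex ^ 'n) set) \<Rightarrow> int" where
  "charge U l = (THE m. \<exists>e. unit_section_charge U l m e)"

definition normalized_unit_section ::
  "(2 \<Rightarrow> real ^ 2 \<Rightarrow> complex ^ 'n ^ 'n) \<Rightarrow> (real ^ 2 \<Rightarrow> (complex ^ 'n) set) \<Rightarrow>
   (real ^ 2 \<Rightarrow> complex ^ 'n) \<Rightarrow> bool" where
  "normalized_unit_section U l e \<longleftrightarrow> unit_section_charge U l (charge U l) e"

definition multiplier ::
  "(real ^ 2 \<Rightarrow> complex ^ 'n ^ 'n) \<Rightarrow> real ^ 2 \<Rightarrow> (real ^ 2 \<Rightarrow> complex ^ 'n) \<Rightarrow> real ^ 2 \<Rightarrow> complex" where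
  "multiplier A \<tau> e w = hinner (e (w + \<tau>)) (A w *v e w)"

definition log_multiplier ::
  "(real ^ 2 \<Rightarrow> complex ^ 'n ^ 'n) \<Rightarrow> real ^ 2 \<Rightarrow> (real ^ 2 \<Rightarrow> complex ^ 'n) \<Rightarrow> real ^ 2 \<Rightarrow> real" where
  "log_multiplier A \<tau> e w = ln (norm (multiplier A \<tau> e w))"

definition multiplier_phase ::
  "(real ^ 2 \<Rightarrow> complex ^ 'n ^ 'n) \<Rightarrow> real ^ 2 \<Rightarrow> int \<Rightarrow> (real ^ 2 \<Rightarrow> complex ^ 'n) \<Rightarrow>
   real ^ 2 \<Rightarrow> complex" where
  "multiplier_phase A \<tau> m e w =
     multiplier A \<tau> e w / of_real (norm (multiplier A \<tau> e w)) * e2pi (of_int m * \<tau> $ 1 * w $ 2)"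

text \<open>\<open>k\<close> is the winding vector of the unimodular function \<open>p\<close> on the torus, and \<open>g\<close> is
  the periodic part of its phase.\<close>

definition winding_phase :: "(real ^ 2 \<Rightarrow> complex) \<Rightarrow> int ^ 2 \<Rightarrow> (real ^ 2 \<Rightarrow> real) \<Rightarrow> bool" where
  "winding_phase p k g \<longleftrightarrow>
     continuous_on UNIV g \<and> torus_periodic g \<and> (\<forall>w. p w = e2pi (zdot k w + g w))"

text \<open>The two values below do not depend on the normalized unit section: two of them differ by
  a unimodular periodic factor \<open>f\<close>, which multiplies the multiplier by
  \<open>f w / f (w + \<tau>)\<close>, a function of modulus 1 and of winding vector 0.\<close>

definition line_winding ::
  "(2 \<Rightarrow> real ^ 2 \<Rightarrow> complex ^ 'n ^ 'n) \<Rightarrow> (real ^ 2 \<Rightarrow> complex ^ 'n ^ 'n) \<Rightarrow> real ^ 2 \<Rightarrow>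
   (real ^ 2 \<Rightarrow> (complex ^ 'n) set) \<Rightarrow> int ^ 2" where
  "line_winding U A \<tau> l =
     (THE k. \<exists>e. normalized_unit_section U l e \<and>
        (\<exists>g. winding_phase (multiplier_phase A \<tau> (charge U l) e) k g))"

definition line_lyapunov_exponent ::
  "(2 \<Rightarrow> real ^ 2 \<Rightarrow> complex ^ 'n ^ 'n) \<Rightarrow> (real ^ 2 \<Rightarrow> complex ^ 'n ^ 'n) \<Rightarrow> real ^ 2 \<Rightarrow>
   (real ^ 2 \<Rightarrow> (complex ^ 'n) set) \<Rightarrow> real" where
  "line_lyapunov_exponent U A \<tau> l =
     (THE x. \<exists>e. normalized_unit_section U l e \<and> x = torus_mean (log_multiplier A \<tau> e))"

subsection \<open>Strip-admissible systems\<close>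

definition strip :: "real \<Rightarrow> (complex ^ 2) set" where
  "strip \<delta> = {z. \<forall>i. \<bar>Im (z $ i)\<bar> \<le> \<delta>}"

definition complexify :: "real ^ 2 \<Rightarrow> complex ^ 2" where
  "complexify w = (\<chi> i. of_real (w $ i))"

text \<open>Holomorphy in two variables: the real Frechet derivative exists and is complex linear.\<close>

definition holomorphic2_on :: "(complex ^ 2 \<Rightarrow> complex) \<Rightarrow> (complex ^ 2) set \<Rightarrow> bool" where
  "holomorphic2_on f W \<longleftrightarrow>
     (\<forall>z\<in>W. \<exists>D. (f has_derivative D) (at z) \<and> (\<forall>c v. D (c *s v) = c * D v))"

definition strip_extendable :: "real \<Rightarrow> (real ^ 2 \<Rightarrow> complex ^ 'n ^ 'n) \<Rightarrow> bool" where
  "strip_extendable \<delta> M \<longleftrightarrow>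
     (\<exists>W N. open W \<and> strip \<delta> \<subseteq> W \<and>
        (\<forall>i j. holomorphic2_on (\<lambda>z. N z $ i $ j) W) \<and>
        bounded (N ` strip \<delta>) \<and>
        (\<forall>w. N (complexify w) = M w))"

definition strip_admissible ::
  "(2 \<Rightarrow> real ^ 2 \<Rightarrow> complex ^ 'n ^ 'n) \<Rightarrow> (real ^ 2 \<Rightarrow> complex ^ 'n ^ 'n) \<Rightarrow> real ^ 2 \<Rightarrow> bool" where
  "strip_admissible U A \<tau> \<longleftrightarrow>
     (\<exists>\<delta>>0. (\<forall>j. strip_extendable \<delta> (U j)) \<and> strip_extendable \<delta> A) \<and>
     (\<forall>j w. unitary (U j w)) \<and>
     (\<forall>w. det (A w) \<noteq> 0) \<and>
     (\<forall>w. U 1 (w + axis 2 1) ** U 2 w = U 2 (w + axis 1 1) ** U 1 w) \<and>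
     (\<forall>j w. A (w + axis j 1) ** U j w = U j (w + \<tau>) ** A w)"

subsection \<open>Dominated splittings\<close>

primrec cocycle_iterate ::
  "(real ^ 2 \<Rightarrow> complex ^ 'n ^ 'n) \<Rightarrow> real ^ 2 \<Rightarrow> nat \<Rightarrow> real ^ 2 \<Rightarrow> complex ^ 'n ^ 'n" where
  "cocycle_iterate A \<tau> 0 w = mat 1"
| "cocycle_iterate A \<tau> (Suc N) w = A (w + of_nat N *\<^sub>R \<tau>) ** cocycle_iterate A \<tau> N w"

definition norm_on_line :: "complex ^ 'n ^ 'n \<Rightarrow> (complex ^ 'n) set \<Rightarrow> real" where
  "norm_on_line M L = (SUP v\<in>{v \<in> L. norm v = 1}. norm (M *v v))"

definition conorm_on_line :: "complex ^ 'n ^ 'n \<Rightarrow> (complex ^ 'n) set \<Rightarrow> real" where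
  "conorm_on_line M L = (INF v\<in>{v \<in> L. norm v = 1}. norm (M *v v))"

text \<open>To be used in rank two only, where distinct lines are automatically complementary.\<close>

definition dominated_splitting ::
  "(2 \<Rightarrow> real ^ 2 \<Rightarrow> complex ^ 'n ^ 'n) \<Rightarrow> (real ^ 2 \<Rightarrow> complex ^ 'n ^ 'n) \<Rightarrow> real ^ 2 \<Rightarrow>
   (real ^ 2 \<Rightarrow> (complex ^ 'n) set) \<Rightarrow> (real ^ 2 \<Rightarrow> (complex ^ 'n) set) \<Rightarrow> bool" where
  "dominated_splitting U A \<tau> ls lu \<longleftrightarrow>
     invariant_line U A \<tau> ls \<and> invariant_line U A \<tau> lu \<and>
     (\<forall>w. ls w \<noteq> lu w) \<and>
     (\<exists>N \<kappa>. N \<ge> 1 \<and> 0 < \<kappa> \<and> \<kappa> < 1 \<and>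
        (\<forall>z. norm_on_line (cocycle_iterate A \<tau> N z) (ls z)
             / conorm_on_line (cocycle_iterate A \<tau> N z) (lu z) \<le> \<kappa>\<^sup>2))"

subsection \<open>Diophantine translations and real-analytic functions\<close>

definition dist_to_int :: "real \<Rightarrow> real" where
  "dist_to_int x = \<bar>x - of_int (round x)\<bar>"

definition diophantine :: "real \<Rightarrow> real \<Rightarrow> real ^ 2 \<Rightarrow> bool" where
  "diophantine c d \<tau> \<longleftrightarrow>
     (\<forall>k::int ^ 2. k \<noteq> 0 \<longrightarrow>
        dist_to_int (zdot k \<tau>) \<ge> c * of_int (\<bar>k $ 1\<bar> + \<bar>k $ 2\<bar>) powr (- d))"

definition real_analytic :: "(real ^ 2 \<Rightarrow> 'a::real_normed_vector) \<Rightarrow> bool" where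
  "real_analytic f \<longleftrightarrow>
     (\<forall>w0. \<exists>r>0. \<exists>a :: nat \<times> nat \<Rightarrow> 'a. \<forall>w\<in>ball w0 r.
        ((\<lambda>(i, j). ((w $ 1 - w0 $ 1) ^ i * (w $ 2 - w0 $ 2) ^ j) *\<^sub>R a (i, j)) has_sum f w) UNIV)"

subsection \<open>The explicit eigensection and its twists\<close>

text \<open>\<open>F\<close> and \<open>\<eta>\<close> arise from a real-analytic normalized unit section \<open>e\<close> and from solutions
  \<open>v1\<close>, \<open>v2\<close> of the cohomological equations for the logarithm of the modulus and for the
  periodic phase \<open>g\<close> of its multiplier. This is an eigensection only when the charge and the
  winding vector vanish.\<close>

definition explicit_eigensection ::
  "(2 \<Rightarrow> real ^ 2 \<Rightarrow> complex ^ 'n ^ 'n) \<Rightarrow> (real ^ 2 \<Rightarrow> complex ^ 'n ^ 'n) \<Rightarrow> real ^ 2 \<Rightarrow>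
   (real ^ 2 \<Rightarrow> (complex ^ 'n) set) \<Rightarrow> (real ^ 2 \<Rightarrow> complex ^ 'n) \<Rightarrow> complex \<Rightarrow> bool" where
  "explicit_eigensection U A \<tau> l F \<eta> \<longleftrightarrow>
     (\<exists>e g v1 v2.
        normalized_unit_section U l e \<and> real_analytic e \<and>
        real_analytic (log_multiplier A \<tau> e) \<and>
        winding_phase (multiplier_phase A \<tau> (charge U l) e) (line_winding U A \<tau> l) g \<and>
        real_analytic g \<and>
        torus_periodic v1 \<and> real_analytic v1 \<and>
        torus_periodic v2 \<and> real_analytic v2 \<and>
        (\<forall>w. v1 w - v1 (w + \<tau>) = log_multiplier A \<tau> e w - torus_mean (log_multiplier A \<tau> e)) \<and>
        (\<forall>w. v2 w - v2 (w + \<tau>) = g w - torus_mean g) \<and>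
        F = (\<lambda>w. exp (- (of_real (v1 w) + 2 * of_real pi * \<i> * of_real (v2 w))) *s e w) \<and>
        \<eta> = of_real (exp (torus_mean (log_multiplier A \<tau> e))) * e2pi (torus_mean g))"

definition twist_section :: "int ^ 2 \<Rightarrow> (real ^ 2 \<Rightarrow> complex ^ 'n) \<Rightarrow> real ^ 2 \<Rightarrow> complex ^ 'n" where
  "twist_section \<nu> F w = e2pi (zdot \<nu> w) *s F w"

definition twist_eigenvalue :: "real ^ 2 \<Rightarrow> int ^ 2 \<Rightarrow> complex \<Rightarrow> complex" where
  "twist_eigenvalue \<tau> \<nu> \<eta> = \<eta> * e2pi (- zdot \<nu> \<tau>)"

end

theory Submission
  imports Defs
begin

text \<open>
  Twisting an eigensection by the character \<open>e2pi (zdot \<nu> w)\<close> keeps it equivariant, because the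
  character is periodic under integer translations, and multiplies the eigenvalue by the constant
  \<open>e2pi (- zdot \<nu> \<tau>)\<close> by which the character fails to be invariant under the translation by \<open>\<tau>\<close>.

  For the converse, the explicit eigensection \<open>F0\<close> vanishes nowhere and spans the line at every
  point. Another eigensection carried by the line is therefore \<open>F w = f w *s F0 w\<close> for a measurable
  scalar function \<open>f\<close> (lemma \<open>eigensection_ratio\<close>). The sewing maps and the cocycle cancel from the
  equations for \<open>F\<close> and \<open>F0\<close>, and what remains is that \<open>f\<close> is periodic and satisfies
  \<open>\<eta> * f (w + \<tau>) = \<eta>0 * f w\<close> almost everywhere: \<open>f\<close> is a measurable eigenfunction of a rotation of
  the torus. By the Diophantine condition \<open>zdot k \<tau>\<close> is never an integer for \<open>k \<noteq> 0\<close>, and then such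
  an \<open>f\<close> is a multiple of a character (theorem \<open>rotation_eigenfunction_is_character\<close>), which makes \<open>F\<close>
  a multiple of a twist of \<open>F0\<close>.

  The theorem on rotations is proved by Fourier analysis. Since \<open>f\<close> need not be integrable, the
  argument is applied to \<open>h = f / (1 + \<bar>f\<bar>)\<close>, which is bounded. The eigenvalue \<open>\<theta> = \<eta>0 / \<eta>\<close> has
  modulus \<open>1\<close> because a rotation preserves the integral, so \<open>h\<close> is an eigenfunction with the same
  eigenvalue. Translation invariance of the integral shows that a Fourier coefficient of \<open>h\<close> at \<open>k\<close>
  can be nonzero only if \<open>\<theta> = e2pi (zdot k \<tau>)\<close>. At most one \<open>k\<close> satisfies this, and at least one
  does because a bounded periodic function with vanishing Fourier coefficients is zero almost
  everywhere. This uniqueness theorem rests on the Stone-Weierstrass theorem on the torus, embedded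
  as a compact subset of \<open>\<complex> \<times> \<complex>\<close>, and on the inner regularity of Lebesgue measure.

  The remaining claims follow from this classification. The eigenvalues all have the modulus of
  \<open>\<eta>0\<close>, which is the exponential of the Lyapunov exponent, and they are dense in that circle by
  Kronecker's theorem, since the first coordinate of \<open>\<tau>\<close> is irrational. A given eigenvalue determines
  the twist, so that each eigenspace is one-dimensional. Finally, a twist of \<open>F0\<close> is the exponential
  of a real-analytic function times the real-analytic unit section, and power series in two variables
  are closed under products and exponentials.
\<close>

section \<open>Characters of the torus\<close>

lemma e2pi_add: "e2pi (x + y) = e2pi x * e2pi y"
  by (simp add: e2pi_def exp_add algebra_simps)

lemma e2pi_0 [simp]: "e2pi 0 = 1"
  by (simp add: e2pi_def)

lemma e2pi_nonzero [simp]: "e2pi x \<noteq> 0"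
  by (simp add: e2pi_def)

lemma e2pi_minus: "e2pi (- x) = inverse (e2pi x)"
  by (simp add: e2pi_def exp_minus)

lemma e2pi_diff: "e2pi (x - y) = e2pi x / e2pi y"
  using e2pi_add [of x "- y"] by (simp add: e2pi_minus divide_inverse)

lemma norm_e2pi [simp]: "norm (e2pi x) = 1"
  by (simp add: e2pi_def)

lemma e2pi_eq_1_iff: "e2pi x = 1 \<longleftrightarrow> x \<in> \<int>"
proof -
  have "e2pi x = 1 \<longleftrightarrow> (\<exists>n::int. x = of_int n)"
    by (auto simp: e2pi_def exp_eq_1)
  then show ?thesis by (auto elim: Ints_cases)
qed

lemma e2pi_of_int [simp]: "e2pi (of_int n) = 1"
  by (simp add: e2pi_eq_1_iff)

lemma e2pi_eq_iff: "e2pi x = e2pi y \<longleftrightarrow> x - y \<in> \<int>"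
  by (simp add: e2pi_eq_1_iff [symmetric] e2pi_diff field_simps)

lemma zdot_alt: "zdot k w = of_int (k $ 1) * w $ 1 + of_int (k $ 2) * w $ 2"
  by (simp add: zdot_def sum_2)

lemma zdot_add_right: "zdot k (v + w) = zdot k v + zdot k w"
  by (simp add: zdot_alt algebra_simps)

lemma zdot_diff_left: "zdot (j - k) w = zdot j w - zdot k w"
  by (simp add: zdot_alt algebra_simps)

lemma zdot_minus_left: "zdot (- k) w = - zdot k w"
  by (simp add: zdot_alt algebra_simps)

lemma zdot_zero_left [simp]: "zdot 0 w = 0"
  by (simp add: zdot_alt)

lemma zdot_axis: "zdot k (axis j 1) = of_int (k $ j)"
  using exhaust_2 [of j] by (auto simp: zdot_alt axis_def)

lemma continuous_on_character: "continuous_on UNIV (\<lambda>w. e2pi (zdot k w))"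
  unfolding zdot_alt e2pi_def by (intro continuous_intros)

section \<open>Periodic functions and translation-invariant integrals\<close>

lemma AE_lebesgue_translation:
  fixes t :: "'a::euclidean_space"
  assumes "AE w in lebesgue. P w"
  shows "AE w in lebesgue. P (w + t)"
proof -
  obtain N where N: "negligible N" "{w. \<not> P w} \<subseteq> N"
    using assms by (auto simp: eventually_ae_filter_negligible)
  have "{w. \<not> P (w + t)} \<subseteq> (+) (- t) ` N"
  proof
    fix w assume "w \<in> {w. \<not> P (w + t)}"
    then have "w + t \<in> N" using N by auto
    then show "w \<in> (+) (- t) ` N" by (rule rev_image_eqI) simp
  qed
  then show ?thesis
    using negligible_translation [OF N(1), of "- t"] unfolding eventually_ae_filter_negligible by blast
qed

definition ae_periodic :: "(real ^ 2 \<Rightarrow> 'a) \<Rightarrow> bool" where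
  "ae_periodic h \<longleftrightarrow> (\<forall>j. AE w in lebesgue. h (w + axis j 1) = h w)"

definition int_vec :: "int ^ 2 \<Rightarrow> real ^ 2" where
  "int_vec k = (\<chi> i. of_int (k $ i))"

text \<open>
  The translations that fix a function almost everywhere form a group.
\<close>

lemma ae_periodic_int_vec:
  assumes "ae_periodic h"
  shows "AE w in lebesgue. h (w + int_vec k) = h w"
proof -
  define H where "H t \<longleftrightarrow> (AE w in lebesgue. h (w + t) = h w)" for t
  have add: "H (s + t)" if "H s" "H t" for s t
    using AE_lebesgue_translation [OF that(1) [unfolded H_def], of t] that(2) unfolding H_def
    by eventually_elim (simp add: add_ac)
  have minus: "H (- t)" if "H t" for t
    using AE_lebesgue_translation [OF that [unfolded H_def], of "- t"] unfolding H_def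
    by eventually_elim simp
  have ax: "H (axis j 1)" for j
    using assms by (simp add: ae_periodic_def H_def)
  have nat: "H (of_nat n *\<^sub>R axis j 1)" for n j
  proof (induction n)
    case 0 show ?case by (simp add: H_def)
  next
    case (Suc n) show ?case using add [OF ax Suc] by (simp add: scaleR_add_left)
  qed
  have int: "H (of_int n *\<^sub>R axis j 1)" for n j
  proof (cases n)
    case (nonneg m) then show ?thesis using nat by simp
  next
    case (neg m) then show ?thesis using minus [OF nat [of "Suc m" j]]
      by (simp add: scaleR_left_diff_distrib scaleR_left_distrib)
  qed
  have "int_vec k = of_int (k $ 1) *\<^sub>R axis 1 1 + of_int (k $ 2) *\<^sub>R axis 2 1"
    by (simp add: vec_eq_iff forall_2 int_vec_def axis_def)
  then show ?thesis using add [OF int int] by (simp add: H_def)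
qed

lemma bounded_measurable_integrable_on_cbox:
  fixes f :: "'a::euclidean_space \<Rightarrow> 'b::euclidean_space"
  assumes "f \<in> borel_measurable lebesgue" "bounded (range f)"
  shows "f integrable_on cbox a b"
proof -
  obtain B where B: "\<And>x. norm (f x) \<le> B"
    using assms(2) by (auto simp: bounded_iff)
  show ?thesis
  proof (rule measurable_bounded_by_integrable_imp_integrable)
    show "f \<in> borel_measurable (lebesgue_on (cbox a b))"
      using assms(1) by (rule measurable_restrict_space1)
    show "(\<lambda>_. B) integrable_on cbox a b" by (rule integrable_const)
  qed (use B in auto)
qed

lemma integral_AE_cong:
  assumes "AE w in lebesgue. f w = g w"
  shows "integral S f = integral S g"
proof -
  obtain N where "negligible N" "{w. f w \<noteq> g w} \<subseteq> N"
    using assms by (auto simp: eventually_ae_filter_negligible)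
  then show ?thesis by (intro integral_spike [of N]) (auto simp: subset_iff, metis)
qed

abbreviation unit_square :: "(real ^ 2) set" where "unit_square \<equiv> cbox 0 1"

text \<open>
  Every point has an integer translate in the unit square, and a countable union of null sets is null.
\<close>

lemma AE_eq_on_unit_square_imp_AE:
  assumes "ae_periodic h" "AE w in lebesgue. w \<in> unit_square \<longrightarrow> h w = c"
  shows "AE w in lebesgue. h w = c"
proof -
  have "AE w in lebesgue. \<forall>k. h (w + int_vec k) = h w"
    using ae_periodic_int_vec [OF assms(1)] by (simp add: AE_all_countable)
  moreover have "AE w in lebesgue. \<forall>k. w + int_vec k \<in> unit_square \<longrightarrow> h (w + int_vec k) = c"
    using AE_lebesgue_translation [OF assms(2)] by (simp add: AE_all_countable)
  ultimately show ?thesis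
  proof eventually_elim
    case (elim w)
    let ?k = "(\<chi> i. - \<lfloor>w $ i\<rfloor>) :: int ^ 2"
    have "w + int_vec ?k \<in> unit_square"
      unfolding mem_box_cart
    proof
      fix i show "0 $ i \<le> (w + int_vec ?k) $ i \<and> (w + int_vec ?k) $ i \<le> 1 $ i"
        using floor_correct [of "w $ i"] by (simp add: int_vec_def) linarith
    qed
    then show ?case using elim by metis
  qed
qed

text \<open>
  It suffices to move the square by a distance \<open>0 \<le> t \<le> 1\<close> along one axis, since integer translations
  change nothing. Then the part that leaves the square at one side is an integer translate of the part
  that enters at the other side.
\<close>

lemma integral_cube_translate_axis:
  fixes f :: "real ^ 2 \<Rightarrow> 'b::euclidean_space"
  assumes meas: "f \<in> borel_measurable lebesgue" "bounded (range f)" and per: "ae_periodic f"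
  shows "integral (cbox (a + s *\<^sub>R axis j 1) (a + s *\<^sub>R axis j 1 + 1)) f = integral (cbox a (a + 1)) f"
proof -
  let ?e = "axis j 1 :: real ^ 2"
  note int = bounded_measurable_integrable_on_cbox [OF meas]
  have shift: "integral (cbox (a + int_vec k) (b + int_vec k)) f = integral (cbox a b) f" for a b k
  proof -
    have "integral (cbox (a + int_vec k) (b + int_vec k)) f = integral (cbox a b) (\<lambda>w. f (w + int_vec k))"
      using integral_shift_cbox [of "a + int_vec k" "int_vec k" "b + int_vec k" f] by simp
    also have "\<dots> = integral (cbox a b) f"
      by (rule integral_AE_cong) (rule ae_periodic_int_vec [OF per])
    finally show ?thesis .
  qed
  have iv: "int_vec (axis j n) = of_int n *\<^sub>R ?e" for n
    by (simp add: vec_eq_iff int_vec_def axis_def)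
  have frac: "integral (cbox (a + t *\<^sub>R ?e) (a + t *\<^sub>R ?e + 1)) f = integral (cbox a (a + 1)) f"
    if t: "0 \<le> t" "t \<le> 1" for t a
  proof -
    have B: "?e \<in> Basis" by (auto simp: Basis_vec_def)
    have in_e: "x \<bullet> ?e = x $ j" for x by (simp add: inner_axis)
    let ?top = "a + 1 + (t - 1) *\<^sub>R ?e"
    \<comment> \<open>The square is cut at height \<open>a $ j + t\<close>, the moved square at height \<open>a $ j + 1\<close>. The upper part
      of the former is the lower part of the latter, and the other two parts differ by one period.\<close>
    have lower: "cbox a (a + 1) \<inter> {x. x \<bullet> ?e \<le> a $ j + t} = cbox a ?top"
      using t exhaust_2 [of j] unfolding in_e set_eq_iff Int_iff mem_Collect_eq mem_box_cart forall_2
      by (auto simp: axis_def)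
    have upper: "cbox a (a + 1) \<inter> {x. x \<bullet> ?e \<ge> a $ j + t} = cbox (a + t *\<^sub>R ?e) (a + 1)"
      using t exhaust_2 [of j] unfolding in_e set_eq_iff Int_iff mem_Collect_eq mem_box_cart forall_2
      by (auto simp: axis_def)
    have moved_lower: "cbox (a + t *\<^sub>R ?e) (a + t *\<^sub>R ?e + 1) \<inter> {x. x \<bullet> ?e \<le> a $ j + 1} = cbox (a + t *\<^sub>R ?e) (a + 1)"
      using t exhaust_2 [of j] unfolding in_e set_eq_iff Int_iff mem_Collect_eq mem_box_cart forall_2
      by (auto simp: axis_def)
    have moved_upper: "cbox (a + t *\<^sub>R ?e) (a + t *\<^sub>R ?e + 1) \<inter> {x. x \<bullet> ?e \<ge> a $ j + 1}
        = cbox (a + int_vec (axis j 1)) (?top + int_vec (axis j 1))"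
      using t exhaust_2 [of j] unfolding in_e iv set_eq_iff Int_iff mem_Collect_eq mem_box_cart forall_2
      by (auto simp: axis_def)
    show ?thesis
      using integral_split [OF int B, of a "a + 1" "a $ j + t"]
        integral_split [OF int B, of "a + t *\<^sub>R ?e" "a + t *\<^sub>R ?e + 1" "a $ j + 1"]
      unfolding lower upper moved_lower moved_upper shift by (simp add: add.commute)
  qed
  have "integral (cbox (a + s *\<^sub>R ?e) (a + s *\<^sub>R ?e + 1)) f
      = integral (cbox (a + frac s *\<^sub>R ?e + int_vec (axis j \<lfloor>s\<rfloor>)) (a + frac s *\<^sub>R ?e + 1 + int_vec (axis j \<lfloor>s\<rfloor>))) f"
    by (rule arg_cong2 [where f = integral])
       (auto simp: iv frac_def algebra_simps)
  also have "\<dots> = integral (cbox a (a + 1)) f"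
    unfolding shift by (intro frac) (auto simp: frac_lt_1 less_imp_le)
  finally show ?thesis .
qed

lemma integral_unit_square_translate:
  fixes f :: "real ^ 2 \<Rightarrow> 'b::euclidean_space"
  assumes "f \<in> borel_measurable lebesgue" "bounded (range f)" "ae_periodic f"
  shows "integral unit_square (\<lambda>w. f (w + t)) = integral unit_square f"
proof -
  have t: "t = t $ 1 *\<^sub>R axis 1 1 + t $ 2 *\<^sub>R axis 2 1"
    by (simp add: vec_eq_iff forall_2 axis_def)
  have "integral unit_square (\<lambda>w. f (w + t)) = integral (cbox t (t + 1)) f"
    using integral_shift_cbox [of t t "t + 1" f] by simp
  also have "\<dots> = integral (cbox (t $ 1 *\<^sub>R axis 1 1) (t $ 1 *\<^sub>R axis 1 1 + 1)) f"
    using integral_cube_translate_axis [OF assms, of "t $ 1 *\<^sub>R axis 1 1" "t $ 2" 2] t by simp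
  also have "\<dots> = integral unit_square f"
    using integral_cube_translate_axis [OF assms, of 0 "t $ 1" 1] by simp
  finally show ?thesis .
qed

section \<open>Uniqueness of Fourier coefficients\<close>

definition fourier_coeff :: "(real ^ 2 \<Rightarrow> complex) \<Rightarrow> int ^ 2 \<Rightarrow> complex" where
  "fourier_coeff h k = integral unit_square (\<lambda>w. h w * e2pi (- zdot k w))"

lemma content_unit_square [simp]: "measure lborel unit_square = 1"
proof -
  have "0 \<in> unit_square" by (simp add: mem_box_cart)
  then have "unit_square \<noteq> {}" by blast
  then show ?thesis by (simp add: content_cbox_cart)
qed

lemma continuous_imp_borel_measurable_lebesgue:
  fixes f :: "'a::euclidean_space \<Rightarrow> 'b::topological_space"
  assumes "continuous_on UNIV f"
  shows "f \<in> borel_measurable lebesgue"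
  using borel_measurable_continuous_onI [OF assms] by (simp add: measurable_completion)

lemma borel_measurable_character: "(\<lambda>w. e2pi (zdot k w)) \<in> borel_measurable lebesgue"
  by (intro continuous_imp_borel_measurable_lebesgue continuous_on_character)

lemma bounded_character: "bounded (range (\<lambda>w. e2pi (zdot k w)))"
  by (auto simp: bounded_iff)

lemma bounded_range_mult:
  fixes f g :: "'a \<Rightarrow> 'b::real_normed_algebra"
  assumes "bounded (range f)" "bounded (range g)"
  shows "bounded (range (\<lambda>x. f x * g x))"
proof -
  obtain a b where ab: "\<And>x. norm (f x) \<le> a" "\<And>x. norm (g x) \<le> b"
    using assms by (auto simp: bounded_iff)
  have "norm (f x * g x) \<le> a * b" for x
    by (rule order_trans [OF norm_mult_ineq mult_mono]) (use ab order_trans [OF norm_ge_zero] in auto)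
  then show ?thesis by (auto simp: bounded_iff)
qed

lemma bounded_range_add:
  fixes f g :: "'a \<Rightarrow> 'b::real_normed_vector"
  assumes "bounded (range f)" "bounded (range g)"
  shows "bounded (range (\<lambda>x. f x + g x))"
proof -
  obtain a b where ab: "\<And>x. norm (f x) \<le> a" "\<And>x. norm (g x) \<le> b"
    using assms by (auto simp: bounded_iff)
  have "norm (f x + g x) \<le> a + b" for x
    by (rule order_trans [OF norm_triangle_ineq add_mono]) (use ab in auto)
  then show ?thesis by (auto simp: bounded_iff)
qed

lemma integrable_times_character:
  assumes "h \<in> borel_measurable lebesgue" "bounded (range h)"
  shows "(\<lambda>w. h w * e2pi (zdot k w)) integrable_on unit_square"
proof (rule bounded_measurable_integrable_on_cbox)
  show "(\<lambda>w. h w * e2pi (zdot k w)) \<in> borel_measurable lebesgue"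
    using assms(1) borel_measurable_character by measurable
qed (rule bounded_range_mult [OF assms(2) bounded_character])

text \<open>
  For \<open>j \<noteq> k\<close> there is a translation under which the character \<open>j - k\<close> changes its sign; the integral
  is invariant under it and hence zero.
\<close>

lemma fourier_coeff_character: "fourier_coeff (\<lambda>w. e2pi (zdot j w)) k = of_bool (j = k)"
proof (cases "j = k")
  case True
  then show ?thesis
    by (simp add: fourier_coeff_def e2pi_minus)
next
  case False
  let ?u = "\<lambda>w. e2pi (zdot (j - k) w)"
  obtain i where i: "(j - k) $ i \<noteq> 0"
    using False by (auto simp: vec_eq_iff)
  let ?t = "axis i (1 / (2 * of_int ((j - k) $ i))) :: real ^ 2"
  have half: "zdot (j - k) ?t = 1 / 2"
    using i exhaust_2 [of i] by (auto simp: zdot_alt axis_def)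
  have "e2pi (1 / 2) = - 1"
    by (simp add: e2pi_def)
  then have "?u (w + ?t) = - ?u w" for w
    by (simp only: zdot_add_right half e2pi_add) simp
  moreover have "integral unit_square (\<lambda>w. ?u (w + ?t)) = integral unit_square ?u"
    by (rule integral_unit_square_translate [OF borel_measurable_character bounded_character])
       (auto simp: ae_periodic_def zdot_add_right zdot_axis e2pi_add simp del: of_int_diff)
  ultimately have "integral unit_square ?u = 0"
    by simp
  moreover have "?u w = e2pi (zdot j w) * e2pi (- zdot k w)" for w
    by (simp add: zdot_diff_left e2pi_add [symmetric])
  ultimately show ?thesis
    using False by (simp add: fourier_coeff_def)
qed

definition fourier_null :: "(real ^ 2 \<Rightarrow> complex) \<Rightarrow> bool" where
  "fourier_null h \<longleftrightarrow>
     h \<in> borel_measurable lebesgue \<and> bounded (range h) \<and> (\<forall>k. fourier_coeff h k = 0)"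

lemma fourier_null_cmult: "fourier_null h \<Longrightarrow> fourier_null (\<lambda>w. h w * c)"
proof -
  assume h: "fourier_null h"
  have "(\<lambda>w. h w * c * e2pi (- zdot k w)) = (\<lambda>w. c * (h w * e2pi (- zdot k w)))" for k
    by (simp add: mult_ac)
  moreover have "bounded (range (\<lambda>w. h w * c))"
    using h by (intro bounded_range_mult) (auto simp: fourier_null_def bounded_iff)
  ultimately show ?thesis
    using h by (auto simp: fourier_null_def fourier_coeff_def)
qed

lemma fourier_null_add:
  assumes "fourier_null g" "fourier_null h"
  shows "fourier_null (\<lambda>w. g w + h w)"
proof -
  have "integral unit_square (\<lambda>w. (g w + h w) * e2pi (- zdot k w)) = 0" for k
  proof -
    have "integral unit_square (\<lambda>w. g w * e2pi (zdot (- k) w) + h w * e2pi (zdot (- k) w))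
        = integral unit_square (\<lambda>w. g w * e2pi (zdot (- k) w)) + integral unit_square (\<lambda>w. h w * e2pi (zdot (- k) w))"
      using assms by (intro integral_add integrable_times_character) (auto simp: fourier_null_def)
    also have "\<dots> = 0"
      using assms by (auto simp: fourier_null_def fourier_coeff_def zdot_minus_left)
    finally show ?thesis by (simp add: zdot_minus_left distrib_right)
  qed
  then show ?thesis
    using assms bounded_range_add by (auto simp: fourier_null_def fourier_coeff_def)
qed

text \<open>
  Multiplication by a character shifts the Fourier coefficients, so it preserves their vanishing. The
  lemmas below extend this closure property from characters to all real polynomials in the coordinates
  of the embedded torus.
\<close>

lemma fourier_null_times_character:
  assumes "fourier_null h"
  shows "fourier_null (\<lambda>w. h w * e2pi (zdot j w))"
proof -
  have "h w * e2pi (zdot j w) * e2pi (- zdot k w) = h w * e2pi (- zdot (k - j) w)" for w k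
    by (simp add: zdot_diff_left e2pi_add [symmetric] mult.assoc)
  then have "fourier_coeff (\<lambda>w. h w * e2pi (zdot j w)) k = fourier_coeff h (k - j)" for k
    by (simp only: fourier_coeff_def)
  moreover have "(\<lambda>w. h w * e2pi (zdot j w)) \<in> borel_measurable lebesgue"
    using assms borel_measurable_character by (auto simp: fourier_null_def)
  moreover have "bounded (range (\<lambda>w. h w * e2pi (zdot j w)))"
    using assms bounded_character by (intro bounded_range_mult) (auto simp: fourier_null_def)
  ultimately show ?thesis
    using assms by (simp add: fourier_null_def)
qed

text \<open>
  The image is a compact subset of a Euclidean space on which Stone-Weierstrass applies; on the unit
  square itself periodic functions do not separate opposite boundary points.
\<close>

definition torus_embedding :: "real ^ 2 \<Rightarrow> complex \<times> complex" where
  "torus_embedding w = (e2pi (w $ 1), e2pi (w $ 2))"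

lemma continuous_on_torus_embedding: "continuous_on S torus_embedding"
  unfolding torus_embedding_def e2pi_def by (intro continuous_intros)

lemma fourier_null_times_Re_Im:
  assumes "fourier_null h"
  shows "fourier_null (\<lambda>w. h w * of_real (Re (e2pi (zdot k w))))"
    and "fourier_null (\<lambda>w. h w * of_real (Im (e2pi (zdot k w))))"
proof -
  have c: "cnj (e2pi (zdot k w)) = e2pi (zdot (- k) w)" for w
    by (simp add: e2pi_def exp_cnj zdot_minus_left)
  have re: "h w * of_real (Re (e2pi (zdot k w)))
      = h w * e2pi (zdot k w) * (1 / 2) + h w * e2pi (zdot (- k) w) * (1 / 2)" for w
    unfolding c [symmetric] by (simp add: complex_eq_iff field_simps)
  have im: "h w * of_real (Im (e2pi (zdot k w)))
      = h w * e2pi (zdot k w) * (- \<i> / 2) + h w * e2pi (zdot (- k) w) * (\<i> / 2)" for w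
    unfolding c [symmetric] by (simp add: complex_eq_iff field_simps)
  show "fourier_null (\<lambda>w. h w * of_real (Re (e2pi (zdot k w))))"
    unfolding re by (intro fourier_null_add fourier_null_cmult fourier_null_times_character assms)
  show "fourier_null (\<lambda>w. h w * of_real (Im (e2pi (zdot k w))))"
    unfolding im by (intro fourier_null_add fourier_null_cmult fourier_null_times_character assms)
qed

text \<open>
  Stated for all \<open>h\<close> with vanishing coefficients rather than as an expansion of \<open>p\<close> into characters,
  the product of two polynomials is handled by applying the two induction hypotheses in turn.
\<close>

lemma fourier_null_times_polynomial:
  assumes "real_polynomial_function p" "fourier_null h"
  shows "fourier_null (\<lambda>w. h w * of_real (p (torus_embedding w)))"
  using assms
proof (induction arbitrary: h rule: real_polynomial_function.induct)
  case (linear f)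
  interpret f: bounded_linear f by fact
  have "f z = Re (fst z) * f (1, 0) + Im (fst z) * f (\<i>, 0) + Re (snd z) * f (0, 1) + Im (snd z) * f (0, \<i>)" for z
  proof -
    have "z = Re (fst z) *\<^sub>R (1, 0) + Im (fst z) *\<^sub>R (\<i>, 0) + Re (snd z) *\<^sub>R (0, 1) + Im (snd z) *\<^sub>R (0, \<i>)"
      by (auto simp: prod_eq_iff complex_eq_iff)
    then show ?thesis by (metis f.add f.scaleR real_scaleR_def)
  qed
  note f_expand = this
  have coord: "w $ i = zdot (axis i 1) w" for w i
    using exhaust_2 [of i] by (auto simp: zdot_alt axis_def)
  have "h w * of_real (f (torus_embedding w))
      = h w * of_real (Re (e2pi (zdot (axis 1 1) w))) * of_real (f (1, 0))
      + h w * of_real (Im (e2pi (zdot (axis 1 1) w))) * of_real (f (\<i>, 0))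
      + h w * of_real (Re (e2pi (zdot (axis 2 1) w))) * of_real (f (0, 1))
      + h w * of_real (Im (e2pi (zdot (axis 2 1) w))) * of_real (f (0, \<i>))" for w
    unfolding f_expand [of "torus_embedding w"]
    by (simp add: torus_embedding_def coord [symmetric] algebra_simps)
  then show ?case
    using linear.prems
    by (simp only:) (intro fourier_null_add fourier_null_cmult fourier_null_times_Re_Im)
next
  case (const c)
  then show ?case by (rule fourier_null_cmult)
next
  case (add f g)
  from fourier_null_add [OF add.IH(1) [OF add.prems] add.IH(2) [OF add.prems]]
  show ?case by (simp add: distrib_left)
next
  case (mult f g)
  from mult.IH(2) [OF mult.IH(1) [OF mult.prems]]
  show ?case by (simp add: mult.assoc)
qed

text \<open>
  Uniform approximation of \<open>\<phi>\<close> on the torus by polynomials, for which the integral is the Fourier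
  coefficient at \<open>0\<close>.
\<close>

lemma fourier_null_integral_continuous:
  assumes h: "fourier_null h" and phi: "continuous_on UNIV \<phi>"
  shows "integral unit_square (\<lambda>w. h w * of_real (\<phi> (torus_embedding w))) = 0"
proof -
  have meas: "h \<in> borel_measurable lebesgue" and "bounded (range h)"
    using h by (auto simp: fourier_null_def)
  then obtain B where B: "\<And>w. norm (h w) \<le> B" and "B > 0"
    by (auto simp: bounded_pos)
  let ?T = "torus_embedding ` unit_square"
  have T: "compact ?T"
    by (intro compact_continuous_image continuous_on_torus_embedding compact_cbox)
  have range: "torus_embedding w \<in> torus_embedding ` unit_square" for w
  proof -
    define v :: "real ^ 2" where "v = (\<chi> i. frac (w $ i))"
    have "torus_embedding v = torus_embedding w"
      by (auto simp: torus_embedding_def v_def e2pi_eq_iff frac_def)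
    moreover have "v \<in> unit_square"
      by (auto simp: v_def mem_box_cart less_imp_le frac_lt_1)
    ultimately show ?thesis by (metis imageI)
  qed
  have bounded_comp: "bounded (range (\<lambda>w. complex_of_real (f (torus_embedding w))))"
    if "continuous_on UNIV f" for f
  proof -
    have "compact (f ` ?T)"
      using T that by (metis compact_continuous_image continuous_on_subset subset_UNIV)
    then obtain C where "\<And>w. norm (f (torus_embedding w)) \<le> C"
      using range compact_imp_bounded [of "f ` ?T"] unfolding bounded_iff by (metis imageI)
    then show ?thesis by (auto simp: bounded_iff)
  qed
  have integ: "(\<lambda>w. h w * of_real (f (torus_embedding w))) integrable_on unit_square"
    if "continuous_on UNIV f" for f
  proof (rule bounded_measurable_integrable_on_cbox)
    have "(\<lambda>w. complex_of_real (f (torus_embedding w))) \<in> borel_measurable lebesgue"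
      by (intro continuous_imp_borel_measurable_lebesgue continuous_on_of_real continuous_on_compose2 [OF that] continuous_on_torus_embedding) simp
    then show "(\<lambda>w. h w * of_real (f (torus_embedding w))) \<in> borel_measurable lebesgue"
      using meas by measurable
    show "bounded (range (\<lambda>w. h w * of_real (f (torus_embedding w))))"
      by (intro bounded_range_mult bounded_comp that \<open>bounded (range h)\<close>)
  qed
  have "norm (integral unit_square (\<lambda>w. h w * of_real (\<phi> (torus_embedding w)))) \<le> \<epsilon>" if "\<epsilon> > 0" for \<epsilon>
  proof -
    obtain p where p: "real_polynomial_function p" "\<And>z. z \<in> ?T \<Longrightarrow> \<bar>\<phi> z - p z\<bar> < \<epsilon> / B"
      using Stone_Weierstrass_real_polynomial_function [OF T continuous_on_subset [OF phi], of "\<epsilon> / B"]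
        \<open>\<epsilon> > 0\<close> \<open>B > 0\<close> by auto
    have pc: "continuous_on UNIV p"
      using p(1) by (simp add: continuous_on_polymonial_function real_polynomial_function_eq)
    have "integral unit_square (\<lambda>w. h w * of_real (p (torus_embedding w)) * e2pi (- zdot 0 w)) = 0"
      using fourier_null_times_polynomial [OF p(1) h]
      unfolding fourier_null_def fourier_coeff_def by blast
    then have p0: "integral unit_square (\<lambda>w. h w * of_real (p (torus_embedding w))) = 0"
      by simp
    have "integral unit_square (\<lambda>w. h w * of_real (\<phi> (torus_embedding w)))
        = integral unit_square (\<lambda>w. h w * of_real (\<phi> (torus_embedding w)) - h w * of_real (p (torus_embedding w)))"
      by (subst integral_diff) (use integ phi pc p0 in auto)
    also have "norm \<dots> \<le> \<epsilon> * measure lborel unit_square"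
    proof (rule integrable_bound)
      show "(\<lambda>w. h w * of_real (\<phi> (torus_embedding w)) - h w * of_real (p (torus_embedding w))) integrable_on unit_square"
        using integ phi pc by (intro integrable_diff)
      fix w assume "w \<in> unit_square"
      then have "\<bar>\<phi> (torus_embedding w) - p (torus_embedding w)\<bar> \<le> \<epsilon> / B"
        using p(2) by (simp add: less_imp_le)
      then have "norm (h w) * \<bar>\<phi> (torus_embedding w) - p (torus_embedding w)\<bar> \<le> B * (\<epsilon> / B)"
        using B by (intro mult_mono) (use \<open>B > 0\<close> in auto)
      moreover have "norm (h w * of_real (\<phi> (torus_embedding w)) - h w * of_real (p (torus_embedding w)))
          = norm (h w) * \<bar>\<phi> (torus_embedding w) - p (torus_embedding w)\<bar>"
        by (metis norm_mult norm_of_real of_real_diff right_diff_distrib)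
      ultimately show "norm (h w * of_real (\<phi> (torus_embedding w)) - h w * of_real (p (torus_embedding w))) \<le> \<epsilon>"
        using \<open>B > 0\<close> by simp
    qed (use \<open>\<epsilon> > 0\<close> in auto)
    finally show ?thesis by simp
  qed
  then have "norm (integral unit_square (\<lambda>w. h w * of_real (\<phi> (torus_embedding w)))) \<le> 0"
    by (rule field_le_epsilon) simp
  then show ?thesis by simp
qed

text \<open>
  The embedding identifies only opposite boundary points of the square. This is why compact sets in its
  interior are used below: the image of such a set pulls back to the set itself.
\<close>

lemma torus_embedding_eq_imp_eq:
  assumes "torus_embedding v = torus_embedding w" "v \<in> box 0 1" "w \<in> unit_square"
  shows "v = w"
proof -
  have "v $ i = w $ i" for i
  proof -
    have "v $ i - w $ i \<in> \<int>"
      using assms(1) exhaust_2 [of i] by (auto simp: torus_embedding_def e2pi_eq_iff)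
    then obtain n :: int where n: "v $ i - w $ i = of_int n" by (auto elim: Ints_cases)
    have "0 < v $ i" "v $ i < 1" "0 \<le> w $ i" "w $ i \<le> 1"
      using assms(2,3) by (auto simp: mem_box_cart)
    then have "\<bar>real_of_int n\<bar> < 1" using n by linarith
    then have "n = 0" by linarith
    then show ?thesis using n by simp
  qed
  then show ?thesis by (simp add: vec_eq_iff)
qed

text \<open>
  The indicator of \<open>K\<close> is the pointwise limit of continuous functions on the torus, namely of cut-offs
  of the distance to the image of \<open>K\<close>.
\<close>

lemma fourier_null_integral_compact:
  assumes h: "fourier_null h" and K: "compact K" "K \<subseteq> box 0 1"
  shows "integral unit_square (\<lambda>w. h w * indicator K w) = 0"
proof (cases "K = {}")
  case False
  let ?K = "torus_embedding ` K"
  define \<phi> where "\<phi> n z = max 0 (1 - real n * infdist z ?K)" for n z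
  have cont: "continuous_on UNIV (\<phi> n)" for n
    unfolding \<phi>_def by (intro continuous_intros)
  have closed: "closed ?K"
    using K(1) by (intro compact_imp_closed compact_continuous_image continuous_on_torus_embedding)
  have meas: "h \<in> borel_measurable lebesgue" and "bounded (range h)"
    using h by (auto simp: fourier_null_def)
  then obtain B where B: "\<And>w. norm (h w) \<le> B"
    by (auto simp: bounded_iff)
  have \<phi>1: "0 \<le> \<phi> n z" "\<phi> n z \<le> 1" for n z
    by (auto simp: \<phi>_def infdist_nonneg)
  have lim: "(\<lambda>n. \<phi> n (torus_embedding w)) \<longlonglongrightarrow> indicator K w" if w: "w \<in> unit_square" for w
  proof (cases "w \<in> K")
    case True
    then show ?thesis by (simp add: \<phi>_def)
  next
    case False
    have "torus_embedding w \<notin> ?K"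
      using torus_embedding_eq_imp_eq [of _ w] w K(2) False by fastforce
    then have pos: "infdist (torus_embedding w) ?K > 0"
      using closed \<open>K \<noteq> {}\<close> in_closed_iff_infdist_zero [of ?K] infdist_nonneg [of _ ?K]
      by (metis image_is_empty less_eq_real_def)
    have "\<forall>\<^sub>F n in sequentially. \<phi> n (torus_embedding w) = 0"
    proof -
      obtain N where N: "1 < real N * infdist (torus_embedding w) ?K"
        using reals_Archimedean3 [OF pos] by blast
      have "\<phi> n (torus_embedding w) = 0" if "n \<ge> N" for n
      proof -
        have "real N * infdist (torus_embedding w) ?K \<le> real n * infdist (torus_embedding w) ?K"
          using that pos by (intro mult_right_mono) auto
        then show ?thesis using N by (simp add: \<phi>_def)
      qed
      then show ?thesis by (auto simp: eventually_sequentially)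
    qed
    then show ?thesis using False by (simp add: tendsto_eventually)
  qed
  have "(\<lambda>n. integral unit_square (\<lambda>w. h w * of_real (\<phi> n (torus_embedding w))))
      \<longlonglongrightarrow> integral unit_square (\<lambda>w. h w * of_real (indicator K w))"
  proof (rule dominated_convergence(2))
    fix n
    show "(\<lambda>w. h w * of_real (\<phi> n (torus_embedding w))) integrable_on unit_square"
    proof (rule bounded_measurable_integrable_on_cbox)
      have "(\<lambda>w. complex_of_real (\<phi> n (torus_embedding w))) \<in> borel_measurable lebesgue"
        by (intro continuous_imp_borel_measurable_lebesgue continuous_on_of_real continuous_on_compose2 [OF cont] continuous_on_torus_embedding) simp
      then show "(\<lambda>w. h w * of_real (\<phi> n (torus_embedding w))) \<in> borel_measurable lebesgue"
        using meas by measurable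
      show "bounded (range (\<lambda>w. h w * of_real (\<phi> n (torus_embedding w))))"
        by (intro bounded_range_mult \<open>bounded (range h)\<close> boundedI [where B = 1]) (auto simp del: split_paired_All simp: \<phi>1)
    qed
    show "(\<lambda>_::real ^ 2. B) integrable_on unit_square" by (rule integrable_const)
    fix w :: "real ^ 2"
    have "norm (h w) * \<bar>\<phi> n (torus_embedding w)\<bar> \<le> B * 1"
      using B \<phi>1 by (intro mult_mono) (auto intro: order_trans [OF norm_ge_zero])
    then show "norm (h w * of_real (\<phi> n (torus_embedding w))) \<le> B"
      by (simp add: norm_mult)
  qed (intro tendsto_intros lim)
  then have "integral unit_square (\<lambda>w. h w * of_real (indicator K w)) = 0"
    using fourier_null_integral_continuous [OF h cont] by (simp add: LIMSEQ_const_iff)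
  moreover have "complex_of_real (indicator K w) = indicator K w" for w
    by (simp add: indicator_def)
  ultimately show ?thesis by simp
qed simp

lemma integral_unit_square_nonneg_zero_imp_AE:
  fixes f :: "real ^ 2 \<Rightarrow> real"
  assumes f: "f \<in> borel_measurable lebesgue" "bounded (range f)" and nonneg: "\<And>w. f w \<ge> 0"
    and zero: "integral unit_square f = 0"
  shows "AE w in lebesgue. w \<in> unit_square \<longrightarrow> f w = 0"
proof -
  have af: "f absolutely_integrable_on unit_square"
    by (intro nonnegative_absolutely_integrable_1 bounded_measurable_integrable_on_cbox f nonneg)
  have "set_lebesgue_integral lebesgue unit_square f = 0"
    using set_lebesgue_integral_eq_integral(2) [OF af] zero by simp
  then have "AE w in lebesgue. indicator unit_square w *\<^sub>R f w = 0"
    using af nonneg unfolding set_lebesgue_integral_def set_integrable_def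
    by (subst (asm) integral_nonneg_eq_0_iff_AE) auto
  then show ?thesis
    by eventually_elim (auto simp: indicator_def split: if_splits)
qed

text \<open>
  The set where \<open>Re h > 0\<close> is, up to a null set, a countable union of compact sets. The integral of
  \<open>Re h\<close> over each of them vanishes although the integrand is positive there, so each is null.
\<close>

lemma fourier_null_imp_Re_nonpos:
  assumes h: "fourier_null h"
  shows "AE w in lebesgue. w \<in> box 0 1 \<longrightarrow> Re (h w) \<le> 0"
proof -
  have meas: "h \<in> borel_measurable lebesgue" and bdd: "bounded (range h)"
    using h by (auto simp: fourier_null_def)
  let ?P = "{w \<in> box 0 1. Re (h w) > 0}"
  have "?P = box 0 1 \<inter> (h -` {z. Re z > 0} \<inter> space lebesgue)" by auto
  also have "\<dots> \<in> sets lebesgue"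
    by (intro sets.Int measurable_sets [OF meas] borel_open open_halfspace_Re_gt) simp
  finally have "?P \<in> sets lebesgue" .
  from lebesgue_regular_inner [OF this]
  obtain N C where N: "negligible N" and C: "\<And>n::nat. compact (C n)" and P: "?P = (\<Union>n. C n) \<union> N"
    by blast
  have "negligible (C n)" for n
  proof -
    have sub: "C n \<subseteq> ?P" using P by auto
    let ?f = "\<lambda>w. indicator (C n) w * Re (h w)"
    have ind: "(indicator (C n) :: _ \<Rightarrow> complex) \<in> borel_measurable lebesgue"
      using C [of n] by (intro borel_measurable_indicator) (simp add: borel_compact)
    have "norm (indicator (C n) w :: complex) \<le> 1" for w
      by (simp add: indicator_def)
    then have "bounded (range (indicator (C n) :: _ \<Rightarrow> complex))"
      by (auto simp: bounded_iff)
    then have f: "(\<lambda>w. h w * indicator (C n) w) \<in> borel_measurable lebesgue"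
        "bounded (range (\<lambda>w. h w * indicator (C n) w))"
      using meas ind bdd by (auto intro: bounded_range_mult)
    have Re: "?f = (\<lambda>w. Re (h w * indicator (C n) w))"
      by (auto simp: indicator_def)
    have "integral unit_square ?f = Re (integral unit_square (\<lambda>w. h w * indicator (C n) w))"
      using integral_linear [OF bounded_measurable_integrable_on_cbox [OF f] bounded_linear_Re]
      unfolding Re by (simp add: o_def)
    also have "\<dots> = 0"
      using fourier_null_integral_compact [OF h C, of n] sub by force
    finally have zero: "integral unit_square ?f = 0" .
    have "AE w in lebesgue. w \<in> unit_square \<longrightarrow> ?f w = 0"
    proof (rule integral_unit_square_nonneg_zero_imp_AE [OF _ _ _ zero])
      show "?f \<in> borel_measurable lebesgue"
        unfolding Re using f(1) by measurable
      show "bounded (range ?f)"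
        unfolding Re using bounded_linear_image [OF f(2) bounded_linear_Re]
        by (simp add: image_image)
      show "?f w \<ge> 0" for w
        using sub by (auto simp: indicator_def)
    qed
    then have "AE w in lebesgue. w \<notin> C n"
    proof eventually_elim
      case (elim w)
      then show ?case using sub box_subset_cbox by (auto simp: indicator_def split: if_splits)
    qed
    then show ?thesis
      unfolding eventually_ae_filter_negligible by (auto intro: negligible_subset)
  qed
  then have "negligible ?P"
    unfolding P using N by (intro negligible_Un negligible_countable_Union) auto
  then show ?thesis
    unfolding eventually_ae_filter_negligible by (rule exI [of _ ?P, OF conjI]) force
qed

text \<open>
  Applying the previous lemma to \<open>h\<close> multiplied by the four units \<open>1\<close>, \<open>- 1\<close>, \<open>\<i>\<close> and \<open>- \<i>\<close> bounds the
  real and the imaginary part from both sides.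
\<close>

theorem fourier_null_imp_AE_zero:
  assumes h: "fourier_null h" and "ae_periodic h"
  shows "AE w in lebesgue. h w = 0"
proof (rule AE_eq_on_unit_square_imp_AE [OF assms(2)])
  have re: "AE w in lebesgue. w \<in> box 0 1 \<longrightarrow> Re (h w * c) \<le> 0" for c
    by (intro fourier_null_imp_Re_nonpos fourier_null_cmult h)
  have "AE w in lebesgue. w \<notin> unit_square - box 0 1"
    unfolding eventually_ae_filter_negligible
    using negligible_frontier_interval [of 0 "1 :: real ^ 2"] by blast
  then show "AE w in lebesgue. w \<in> unit_square \<longrightarrow> h w = 0"
    using re [of 1] re [of "- 1"] re [of \<i>] re [of "- \<i>"]
    by eventually_elim (auto simp: complex_eq_iff)
qed

section \<open>Real-analytic functions of two variables\<close>

definition bimonomial :: "real ^ 2 \<Rightarrow> nat \<times> nat \<Rightarrow> real" where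
  "bimonomial u p = u $ 1 ^ fst p * u $ 2 ^ snd p"

lemma real_analytic_alt:
  "real_analytic f \<longleftrightarrow>
     (\<forall>w0. \<exists>r>0. \<exists>a. \<forall>w\<in>ball w0 r. ((\<lambda>p. bimonomial (w - w0) p *\<^sub>R a p) has_sum f w) UNIV)"
  unfolding real_analytic_def bimonomial_def by (simp add: case_prod_unfold)

lemma bimonomial_0: "bimonomial u (0, 0) = 1"
  by (simp add: bimonomial_def)

text \<open>
  An expansion of \<open>f\<close> at \<open>w0\<close>, valid on the ball of radius \<open>r\<close>. Products and exponentials keep the
  ball on which their arguments are expanded.
\<close>

definition power_series_at :: "real ^ 2 \<Rightarrow> real \<Rightarrow> (nat \<times> nat \<Rightarrow> 'a) \<Rightarrow> (real ^ 2 \<Rightarrow> 'a::real_normed_vector) \<Rightarrow> bool" where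
  "power_series_at w0 r a f \<longleftrightarrow>
     (\<forall>w\<in>ball w0 r. ((\<lambda>p. bimonomial (w - w0) p *\<^sub>R a p) has_sum f w) UNIV)"

lemma real_analytic_iff_power_series:
  "real_analytic f \<longleftrightarrow> (\<forall>w0. \<exists>r>0. \<exists>a. power_series_at w0 r a f)"
  by (simp add: real_analytic_alt power_series_at_def)

lemma power_series_at_mono: "power_series_at w0 r a f \<Longrightarrow> s \<le> r \<Longrightarrow> power_series_at w0 s a f"
  by (auto simp: power_series_at_def)

lemma real_analytic_common_radius:
  assumes "real_analytic f" "real_analytic g"
  obtains r a b where "r > 0" "power_series_at w0 r a f" "power_series_at w0 r b g"
proof -
  obtain r a s b where "r > 0" "power_series_at w0 r a f" "s > 0" "power_series_at w0 s b g"
    using assms unfolding real_analytic_iff_power_series by meson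
  then show thesis
    using that [of "min r s" a b] power_series_at_mono [of w0 r a f "min r s"]
      power_series_at_mono [of w0 s b g "min r s"] by simp
qed

lemma real_analytic_linear:
  assumes "bounded_linear T" "real_analytic f"
  shows "real_analytic (\<lambda>w. T (f w))"
  unfolding real_analytic_iff_power_series
proof
  fix w0
  interpret T: bounded_linear T by fact
  obtain r a where r: "r > 0" "power_series_at w0 r a f"
    using assms(2) unfolding real_analytic_iff_power_series by meson
  have "power_series_at w0 r (\<lambda>p. T (a p)) (\<lambda>w. T (f w))"
    using r(2) has_sum_bounded_linear [OF assms(1)] unfolding power_series_at_def
    by (fastforce simp: T.scaleR)
  then show "\<exists>r>0. \<exists>a. power_series_at w0 r a (\<lambda>w. T (f w))" using r(1) by blast
qed

lemma real_analytic_add: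
  assumes "real_analytic f" "real_analytic g"
  shows "real_analytic (\<lambda>w. f w + g w)"
  unfolding real_analytic_iff_power_series
proof
  fix w0
  obtain r a b where r: "r > 0" "power_series_at w0 r a f" "power_series_at w0 r b g"
    using real_analytic_common_radius [OF assms] .
  then have "power_series_at w0 r (\<lambda>p. a p + b p) (\<lambda>w. f w + g w)"
    unfolding power_series_at_def scaleR_add_right by (auto intro: has_sum_add)
  then show "\<exists>r>0. \<exists>a. power_series_at w0 r a (\<lambda>w. f w + g w)" using r(1) by blast
qed

lemma real_analytic_const: "real_analytic (\<lambda>w. c)"
  unfolding real_analytic_iff_power_series
proof
  fix w0
  define a where "a = (\<lambda>p::nat \<times> nat. if p = (0, 0) then c else 0)"
  have "((\<lambda>p. bimonomial (w - w0) p *\<^sub>R a p) has_sum c) UNIV" for w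
  proof -
    have "((\<lambda>p. bimonomial (w - w0) p *\<^sub>R a p) has_sum c) {(0, 0)}"
      by (rule has_sum_finiteI) (auto simp: a_def bimonomial_def)
    then show ?thesis
      by (rule has_sum_cong_neutral [THEN iffD1, rotated 3]) (auto simp: a_def)
  qed
  then have "power_series_at w0 1 a (\<lambda>w. c)" by (simp add: power_series_at_def)
  then show "\<exists>r>0. \<exists>a. power_series_at w0 r a (\<lambda>w. c)" using zero_less_one by blast
qed

lemma real_analytic_zdot: "real_analytic (\<lambda>w. zdot k w)"
  unfolding real_analytic_iff_power_series
proof
  fix w0
  define a where "a = (\<lambda>p::nat \<times> nat. if p = (0, 0) then zdot k w0
    else if p = (1, 0) then of_int (k $ 1) else if p = (0, 1) then of_int (k $ 2) else (0::real))"
  have "((\<lambda>p. bimonomial (w - w0) p *\<^sub>R a p) has_sum zdot k w) UNIV" for w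
  proof -
    have "((\<lambda>p. bimonomial (w - w0) p *\<^sub>R a p) has_sum zdot k w) {(0, 0), (1, 0), (0, 1)}"
      by (rule has_sum_finiteI) (auto simp: a_def bimonomial_def zdot_alt algebra_simps)
    then show ?thesis
      by (rule has_sum_cong_neutral [THEN iffD1, rotated 3]) (auto simp: a_def)
  qed
  then have "power_series_at w0 1 a (\<lambda>w. zdot k w)" by (simp add: power_series_at_def)
  then show "\<exists>r>0. \<exists>a. power_series_at w0 r a (\<lambda>w. zdot k w)" using zero_less_one by blast
qed

definition cauchy_coeff :: "(nat \<times> nat \<Rightarrow> complex) \<Rightarrow> (nat \<times> nat \<Rightarrow> complex) \<Rightarrow> nat \<times> nat \<Rightarrow> complex" where
  "cauchy_coeff a b s = (\<Sum>(i, j)\<in>{..fst s} \<times> {..snd s}. a (i, j) * b (fst s - i, snd s - j))"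

lemma has_sum_imp_norm_summable:
  fixes f :: "'a \<Rightarrow> complex"
  assumes "(f has_sum x) S"
  shows "(\<lambda>p. norm (f p)) summable_on S"
  using has_sum_imp_summable [OF assms] by (simp only: summable_on_iff_abs_summable_on_complex)

text \<open>
  Unconditional convergence in \<open>\<complex>\<close> is absolute, so the double series of the product may be summed
  along the pairs of exponents with a given sum, of which there are finitely many.
\<close>

lemma has_sum_cauchy_coeff:
  assumes "((\<lambda>p. bimonomial u p *\<^sub>R a p) has_sum x) UNIV"
    and "((\<lambda>p. bimonomial u p *\<^sub>R b p) has_sum y) UNIV"
  shows "((\<lambda>s. bimonomial u s *\<^sub>R cauchy_coeff a b s) has_sum (x * y)) UNIV"
proof -
  let ?A = "\<lambda>p. bimonomial u p *\<^sub>R a p" and ?B = "\<lambda>p. bimonomial u p *\<^sub>R b p"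
  have absA: "(\<lambda>p. norm (?A p)) summable_on UNIV" and absB: "(\<lambda>p. norm (?B p)) summable_on UNIV"
    by (rule has_sum_imp_norm_summable [OF assms(1)], rule has_sum_imp_norm_summable [OF assms(2)])
  let ?F = "\<lambda>(p, q). ?A p * ?B q"
  have "(\<lambda>x. norm (?F x)) summable_on UNIV \<times> UNIV"
  proof -
    obtain N where "((\<lambda>q. norm (?B q)) has_sum N) UNIV"
      using absB by (auto simp: summable_on_def)
    then have "((\<lambda>q. norm (?A p) * norm (?B q)) has_sum norm (?A p) * N) UNIV" for p
      by (rule has_sum_cmult_right)
    moreover have "(\<lambda>p. norm (?A p) * N) summable_on UNIV"
      using absA by (rule summable_on_cmult_left)
    ultimately have "(\<lambda>(p, q). norm (?A p) * norm (?B q)) summable_on UNIV \<times> UNIV"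
      by (intro summable_on_SigmaI [where g = "\<lambda>p. norm (?A p) * N"]) auto
    moreover have "(\<lambda>x. norm (?F x)) = (\<lambda>(p, q). norm (?A p) * norm (?B q))"
      by (simp only: case_prod_unfold norm_mult)
    ultimately show ?thesis by (simp only:)
  qed
  then have "?F summable_on UNIV \<times> UNIV"
    by (rule Infinite_Sum.abs_summable_summable)
  moreover have "((\<lambda>q. ?F (p, q)) has_sum ?A p * y) UNIV" for p
    using has_sum_cmult_right [OF assms(2), of "?A p"] by simp
  moreover have "((\<lambda>p. ?A p * y) has_sum x * y) UNIV"
    by (rule has_sum_cmult_left [OF assms(1)])
  ultimately have F: "(?F has_sum x * y) (UNIV \<times> UNIV)"
    by (intro has_sum_SigmaI [where g = "\<lambda>p. ?A p * y"]) auto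
  let ?G = "\<lambda>(s, p). ?F (p, (fst s - fst p, snd s - snd p))"
  let ?D = "SIGMA s:UNIV. {..fst s} \<times> {..snd s}"
  have "(?G has_sum x * y) ?D \<longleftrightarrow> (?F has_sum x * y) (UNIV \<times> UNIV)"
    by (rule has_sum_reindex_bij_witness [where j = "\<lambda>(s, p). (p, (fst s - fst p, snd s - snd p))"
          and i = "\<lambda>(p, q). ((fst p + fst q, snd p + snd q), p)"]) auto
  with F have G: "(?G has_sum x * y) ?D" by simp
  show ?thesis
  proof (rule has_sum_SigmaD [OF G])
    fix s :: "nat \<times> nat"
    have "(\<Sum>p\<in>{..fst s} \<times> {..snd s}. ?G (s, p)) = bimonomial u s *\<^sub>R cauchy_coeff a b s"
      unfolding cauchy_coeff_def scaleR_sum_right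
    proof (rule sum.cong)
      fix p assume "p \<in> {..fst s} \<times> {..snd s}"
      then have "u $ 1 ^ fst s = u $ 1 ^ fst p * u $ 1 ^ (fst s - fst p)"
          "u $ 2 ^ snd s = u $ 2 ^ snd p * u $ 2 ^ (snd s - snd p)"
        by (auto simp: power_add [symmetric])
      then have "bimonomial u s = bimonomial u p * bimonomial u (fst s - fst p, snd s - snd p)"
        by (simp add: bimonomial_def)
      then show "?G (s, p) = bimonomial u s *\<^sub>R (case p of (i, j) \<Rightarrow> a (i, j) * b (fst s - i, snd s - j))"
        by (simp add: case_prod_unfold scaleR_conv_of_real)
    qed simp
    then show "((\<lambda>p. ?G (s, p)) has_sum bimonomial u s *\<^sub>R cauchy_coeff a b s) ({..fst s} \<times> {..snd s})"
      by (intro has_sum_finiteI) auto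
  qed
qed

lemma real_analytic_mult:
  fixes f g :: "real ^ 2 \<Rightarrow> complex"
  assumes "real_analytic f" "real_analytic g"
  shows "real_analytic (\<lambda>w. f w * g w)"
  unfolding real_analytic_iff_power_series
proof
  fix w0
  obtain r a b where r: "r > 0" "power_series_at w0 r a f" "power_series_at w0 r b g"
    using real_analytic_common_radius [OF assms] .
  then have "power_series_at w0 r (cauchy_coeff a b) (\<lambda>w. f w * g w)"
    unfolding power_series_at_def by (auto intro: has_sum_cauchy_coeff)
  then show "\<exists>r>0. \<exists>a. power_series_at w0 r a (\<lambda>w. f w * g w)" using r(1) by blast
qed

lemma has_sum_vec_iff:
  fixes f :: "'a \<Rightarrow> 'b::real_normed_vector ^ 'n"
  shows "(f has_sum x) S \<longleftrightarrow> (\<forall>i. ((\<lambda>p. f p $ i) has_sum x $ i) S)"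
proof -
  have "(f has_sum x) S \<longleftrightarrow> (\<forall>i. ((\<lambda>X. sum f X $ i) \<longlongrightarrow> x $ i) (finite_subsets_at_top S))"
    unfolding has_sum_def using vec_tendstoI tendsto_vec_nth by blast
  then show ?thesis by (simp add: has_sum_def)
qed

lemma real_analytic_vec_mult:
  fixes f :: "real ^ 2 \<Rightarrow> complex" and g :: "real ^ 2 \<Rightarrow> complex ^ 'n"
  assumes "real_analytic f" "real_analytic g"
  shows "real_analytic (\<lambda>w. f w *s g w)"
  unfolding real_analytic_iff_power_series
proof
  fix w0
  obtain r a b where r: "r > 0" "power_series_at w0 r a f" "power_series_at w0 r b g"
    using real_analytic_common_radius [OF assms] .
  then have "power_series_at w0 r (\<lambda>s. \<chi> i. cauchy_coeff a (\<lambda>p. b p $ i) s) (\<lambda>w. f w *s g w)"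
    unfolding power_series_at_def has_sum_vec_iff by (auto intro: has_sum_cauchy_coeff)
  then show "\<exists>r>0. \<exists>a. power_series_at w0 r a (\<lambda>w. f w *s g w)" using r(1) by blast
qed

primrec power_coeff :: "(nat \<times> nat \<Rightarrow> complex) \<Rightarrow> nat \<Rightarrow> nat \<times> nat \<Rightarrow> complex" where
  "power_coeff a 0 = (\<lambda>p. of_bool (p = (0, 0)))"
| "power_coeff a (Suc n) = cauchy_coeff a (power_coeff a n)"

lemma has_sum_power_coeff:
  assumes "((\<lambda>p. bimonomial u p *\<^sub>R a p) has_sum x) UNIV"
  shows "((\<lambda>p. bimonomial u p *\<^sub>R power_coeff a n p) has_sum x ^ n) UNIV"
proof (induction n)
  case 0
  have "((\<lambda>p. bimonomial u p *\<^sub>R power_coeff a 0 p) has_sum 1) {(0, 0)}"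
    by (rule has_sum_finiteI) (auto simp: bimonomial_0)
  then have "((\<lambda>p. bimonomial u p *\<^sub>R power_coeff a 0 p) has_sum 1) UNIV"
    by (rule has_sum_cong_neutral [THEN iffD1, rotated 3]) auto
  then show ?case by simp
next
  case (Suc n)
  then show ?case using has_sum_cauchy_coeff [OF assms Suc] by simp
qed

text \<open>
  The coefficients of the powers of a series are majorised by those of the powers of the series of
  absolute values. The latter are real numbers in a complex type, hence the real part.
\<close>

lemma norm_power_coeff_le:
  "norm (power_coeff a n s) \<le> Re (power_coeff (\<lambda>p. of_real (norm (a p))) n s)"
proof (induction n arbitrary: s)
  case 0
  then show ?case by auto
next
  case (Suc n)
  let ?P = "power_coeff (\<lambda>p. of_real (norm (a p))) n"
  let ?q = "\<lambda>p. (fst s - fst p, snd s - snd p)"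
  let ?I = "{..fst s} \<times> {..snd s}"
  have "norm (power_coeff a (Suc n) s) \<le> (\<Sum>p\<in>?I. norm (a p) * norm (power_coeff a n (?q p)))"
    by (auto simp: cauchy_coeff_def case_prod_unfold norm_mult intro: order_trans [OF norm_sum])
  also have "\<dots> \<le> (\<Sum>p\<in>?I. norm (a p) * Re (?P (?q p)))"
    using Suc by (intro sum_mono mult_left_mono) auto
  also have "\<dots> = Re (power_coeff (\<lambda>p. of_real (norm (a p))) (Suc n) s)"
    by (simp add: cauchy_coeff_def case_prod_unfold)
  finally show ?case .
qed

text \<open>
  Expanding every power of \<open>f\<close> in the exponential series gives a double series, which may be summed
  first over the powers if it converges absolutely. To see this at \<open>w\<close>, the expansion of \<open>f\<close> is used
  at the point \<open>w0 + v\<close> whose displacement has the coordinates \<open>\<bar>(w - w0) $ i\<bar>\<close>. It lies in the same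
  ball, and there the series of absolute values has a sum \<open>B\<close>, so that the double series is majorised
  by the exponential series of \<open>B\<close>.
\<close>

lemma real_analytic_exp:
  fixes f :: "real ^ 2 \<Rightarrow> complex"
  assumes "real_analytic f"
  shows "real_analytic (\<lambda>w. exp (f w))"
  unfolding real_analytic_iff_power_series
proof
  fix w0
  obtain r a where r: "r > 0" "power_series_at w0 r a f"
    using assms unfolding real_analytic_iff_power_series by meson
  define c where "c = (\<lambda>p. \<Sum>\<^sub>\<infinity>n. power_coeff a n p / fact n)"
  have "((\<lambda>p. bimonomial (w - w0) p *\<^sub>R c p) has_sum exp (f w)) UNIV" if w: "w \<in> ball w0 r" for w
  proof -
    define v :: "real ^ 2" where "v = (\<chi> i. \<bar>(w - w0) $ i\<bar>)"
    let ?u = "w - w0"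
    let ?b = "\<lambda>p. complex_of_real (norm (a p))"
    have v_mono: "bimonomial v p = \<bar>bimonomial ?u p\<bar>" for p
      by (simp add: v_def bimonomial_def abs_mult power_abs)
    have "norm v = norm ?u"
      by (simp add: v_def norm_vec_def)
    then have "w0 + v \<in> ball w0 r"
      using w by (simp add: dist_norm norm_minus_commute)
    then have "((\<lambda>p. bimonomial v p *\<^sub>R a p) has_sum f (w0 + v)) UNIV"
      using r(2) unfolding power_series_at_def by force
    then have "(\<lambda>p. norm (bimonomial v p *\<^sub>R a p)) summable_on UNIV"
      by (rule has_sum_imp_norm_summable)
    then have "(\<lambda>p. bimonomial v p * norm (a p)) summable_on UNIV"
      by (simp add: v_mono)
    then obtain B where "((\<lambda>p. bimonomial v p * norm (a p)) has_sum B) UNIV"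
      by (auto simp: summable_on_def)
    from has_sum_of_real [OF this, where 'a = complex]
    have "((\<lambda>p. bimonomial v p *\<^sub>R ?b p) has_sum of_real B) UNIV"
      by (simp add: scaleR_conv_of_real)
    from has_sum_power_coeff [OF this]
    have "((\<lambda>p. bimonomial v p *\<^sub>R power_coeff ?b n p) has_sum of_real (B ^ n)) UNIV" for n
      by simp
    from has_sum_Re [OF this]
    have maj: "((\<lambda>p. bimonomial v p * Re (power_coeff ?b n p)) has_sum B ^ n) UNIV" for n
      by (simp only: scaleR_complex.sel Re_complex_of_real)
    have nonneg: "0 \<le> bimonomial v p * Re (power_coeff ?b n p)" for n p
      using norm_power_coeff_le [of a n p] norm_ge_zero [of "power_coeff a n p"]
      by (intro mult_nonneg_nonneg) (auto simp only: v_mono abs_ge_zero)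
    have B: "B \<ge> 0"
      using has_sum_nonneg [OF maj [of 1] nonneg] by simp
    let ?M = "\<lambda>(n, p). bimonomial v p * Re (power_coeff ?b n p) / fact n"
    have "(\<lambda>n. B ^ n / fact n) summable_on UNIV"
      using summable_exp [of B] B
      by (intro norm_summable_imp_summable_on) (simp add: field_simps)
    then have "?M summable_on (UNIV \<times> UNIV)"
      using maj nonneg
      by (intro summable_on_SigmaI [where g = "\<lambda>n. B ^ n / fact n"])
         (auto intro: has_sum_divide_const)
    let ?F = "\<lambda>(n, p). bimonomial ?u p *\<^sub>R (power_coeff a n p / fact n)"
    have "(\<lambda>x. norm (?F x)) summable_on (UNIV \<times> UNIV)"
    proof (rule Infinite_Sum.abs_summable_on_comparison_test' [OF \<open>?M summable_on (UNIV \<times> UNIV)\<close>])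
      fix x :: "nat \<times> nat \<times> nat"
      show "norm (?F x) \<le> ?M x"
        using norm_power_coeff_le [of a "fst x" "snd x"]
        by (auto simp: case_prod_unfold norm_divide v_mono intro!: divide_right_mono mult_left_mono)
    qed
    then have F: "?F summable_on (UNIV \<times> UNIV)"
      by (rule Infinite_Sum.abs_summable_summable)
    have "((\<lambda>p. ?F (n, p)) has_sum f w ^ n / fact n) UNIV" for n
    proof -
      have "((\<lambda>p. bimonomial ?u p *\<^sub>R a p) has_sum f w) UNIV"
        using r(2) w unfolding power_series_at_def by blast
      from has_sum_divide_const [OF has_sum_power_coeff [OF this, of n], of "fact n"]
      show ?thesis by (simp add: scaleR_conv_of_real)
    qed
    moreover have "((\<lambda>n. f w ^ n / fact n) has_sum exp (f w)) UNIV"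
    proof (rule norm_summable_imp_has_sum)
      show "summable (\<lambda>n. norm (f w ^ n / fact n))"
        using summable_norm_exp [of "f w"] by (simp add: norm_divide norm_mult field_simps scaleR_conv_of_real)
      show "(\<lambda>n. f w ^ n / fact n) sums exp (f w)"
        using exp_converges [of "f w"] by (simp add: scaleR_conv_of_real field_simps)
    qed
    ultimately have "(?F has_sum exp (f w)) (UNIV \<times> UNIV)"
      using F by (intro has_sum_SigmaI [where g = "\<lambda>n. f w ^ n / fact n"]) auto
    then have G: "((\<lambda>(p, n). ?F (n, p)) has_sum exp (f w)) (UNIV \<times> UNIV)"
      by (subst (asm) has_sum_swap)
    show ?thesis
    proof (rule has_sum_SigmaD [OF G])
      fix p :: "nat \<times> nat"
      show "((\<lambda>n. case (p, n) of (p, n) \<Rightarrow> ?F (n, p)) has_sum bimonomial ?u p *\<^sub>R c p) UNIV"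
      proof (cases "bimonomial ?u p = 0")
        case True
        then show ?thesis by simp
      next
        case False
        have "(\<lambda>n. bimonomial ?u p *\<^sub>R (power_coeff a n p / fact n)) summable_on UNIV"
          using summable_on_SigmaD1 [of "\<lambda>p n. ?F (n, p)" UNIV "\<lambda>_. UNIV" p] G
          by (auto simp: summable_on_def)
        then have "(\<lambda>n. inverse (bimonomial ?u p) *\<^sub>R (bimonomial ?u p *\<^sub>R (power_coeff a n p / fact n))) summable_on UNIV"
          by (rule summable_on_bounded_linear [OF bounded_linear_scaleR_right])
        then have "(\<lambda>n. power_coeff a n p / fact n) summable_on UNIV"
          using False by simp
        then have "((\<lambda>n. power_coeff a n p / fact n) has_sum c p) UNIV"
          unfolding c_def by (rule has_sum_infsum)
        from has_sum_bounded_linear [OF bounded_linear_scaleR_right this]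
        show ?thesis by simp
      qed
    qed
  qed
  then have "power_series_at w0 r c (\<lambda>w. exp (f w))" by (simp add: power_series_at_def)
  then show "\<exists>r>0. \<exists>a. power_series_at w0 r a (\<lambda>w. exp (f w))" using r(1) by blast
qed

section \<open>Measurable eigenfunctions of a rotation of the torus\<close>

lemma ae_periodic_compose:
  assumes "ae_periodic f"
  shows "ae_periodic (\<lambda>w. g (f w))"
  unfolding ae_periodic_def
proof
  fix j
  have "AE w in lebesgue. f (w + axis j 1) = f w"
    using assms by (simp add: ae_periodic_def)
  then show "AE w in lebesgue. g (f (w + axis j 1)) = g (f w)"
    by eventually_elim simp
qed

lemma ae_periodic_times_character:
  assumes "ae_periodic f"
  shows "ae_periodic (\<lambda>w. f w * e2pi (zdot k w))"
  unfolding ae_periodic_def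
proof
  fix j
  have "AE w in lebesgue. f (w + axis j 1) = f w"
    using assms by (simp add: ae_periodic_def)
  then show "AE w in lebesgue. f (w + axis j 1) * e2pi (zdot k (w + axis j 1)) = f w * e2pi (zdot k w)"
    by eventually_elim (simp add: zdot_add_right zdot_axis e2pi_add)
qed

text \<open>
  A bounded, injective substitute for the identity that commutes with multiplication by unimodular
  numbers; it turns a measurable eigenfunction into a bounded one without loss of information.
\<close>

definition squash :: "complex \<Rightarrow> complex" where
  "squash z = z / of_real (1 + norm z)"

lemma one_plus_norm_nonzero: "1 + complex_of_real (norm (z :: complex)) \<noteq> 0"
proof -
  have "1 + norm z > 0" by (simp add: add_pos_nonneg)
  then have "complex_of_real (1 + norm z) \<noteq> 0" unfolding of_real_eq_0_iff by simp
  then show ?thesis by simp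
qed

lemma norm_squash: "norm (squash z) = norm z / (1 + norm z)"
  unfolding squash_def norm_divide norm_of_real by simp

lemma norm_squash_less_1: "norm (squash z) < 1"
proof -
  have "1 + norm z > 0" by (simp add: add_pos_nonneg)
  then show ?thesis by (simp add: norm_squash divide_less_eq)
qed

lemma unsquash: "squash z / of_real (1 - norm (squash z)) = z"
proof -
  have n: "1 + norm z > 0" by (simp add: add_pos_nonneg)
  have "1 - norm (squash z) = 1 / (1 + norm z)"
    using n by (simp add: norm_squash field_simps)
  then show ?thesis
    using one_plus_norm_nonzero [of z] by (simp add: squash_def)
qed

lemma squash_measurable:
  assumes "f \<in> borel_measurable lebesgue"
  shows "(\<lambda>w. squash (f w)) \<in> borel_measurable lebesgue"
  unfolding squash_def using assms by measurable

lemma bounded_squash: "bounded (range (\<lambda>w. squash (f w)))"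
  by (rule boundedI [where B = 1]) (auto simp: less_imp_le [OF norm_squash_less_1])

lemma squash_eq_0_iff [simp]: "squash z = 0 \<longleftrightarrow> z = 0"
  using one_plus_norm_nonzero [of z] by (simp add: squash_def)

lemma squash_mult_unimodular: "norm u = 1 \<Longrightarrow> squash (u * z) = u * squash z"
  by (simp add: squash_def norm_mult)

text \<open>
  The integral of \<open>a (norm (f w))\<close> with \<open>a t = t / (1 + t)\<close> is invariant under the rotation, which
  replaces \<open>norm (f w)\<close> by \<open>norm \<theta> * norm (f w)\<close>. If \<open>norm \<theta> \<noteq> 1\<close>, strict monotonicity of \<open>a\<close> changes
  the integrand in one direction wherever \<open>f\<close> is not zero.
\<close>

lemma rotation_eigenvalue_unimodular:
  fixes f :: "real ^ 2 \<Rightarrow> complex"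
  assumes f: "f \<in> borel_measurable lebesgue" "ae_periodic f" "\<not> (AE w in lebesgue. f w = 0)"
    and eq: "AE w in lebesgue. f (w + \<tau>) = \<theta> * f w"
  shows "norm \<theta> = 1"
proof (rule ccontr)
  assume ne: "norm \<theta> \<noteq> 1"
  define a where "a t = t / (1 + t)" for t :: real
  \<comment> \<open>The sign for which \<open>d\<close> is nonnegative.\<close>
  define s :: real where "s = (if norm \<theta> > 1 then 1 else - 1)"
  define d where "d w = s * (a (norm \<theta> * norm (f w)) - a (norm (f w)))" for w
  have a01: "0 \<le> a t" "a t \<le> 1" if "t \<ge> 0" for t
    using that by (auto simp: a_def divide_le_eq)
  have a_mono: "a x \<le> a y \<longleftrightarrow> x \<le> y" if "x \<ge> 0" "y \<ge> 0" for x y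
    using that by (simp add: a_def divide_le_eq le_divide_eq frac_le_eq) (simp add: field_simps add_pos_nonneg)
  have a_inj: "a x = a y \<longleftrightarrow> x = y" if "x \<ge> 0" "y \<ge> 0" for x y
    using a_mono [of x y] a_mono [of y x] that by (auto intro: antisym)
  have nf: "(\<lambda>w. norm (f w)) \<in> borel_measurable lebesgue"
    using f(1) by measurable
  have meas: "(\<lambda>w. a (r * norm (f w))) \<in> borel_measurable lebesgue" for r
    unfolding a_def using nf by measurable
  have bdd: "bounded (range (\<lambda>w. a (r * norm (f w))))" if "r \<ge> 0" for r
  proof (rule boundedI)
    fix x assume "x \<in> range (\<lambda>w. a (r * norm (f w)))"
    then obtain w where "x = a (r * norm (f w))" by blast
    then show "norm x \<le> 1" using a01 [of "r * norm (f w)"] that by simp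
  qed
  have int: "(\<lambda>w. a (r * norm (f w))) integrable_on unit_square" if "r \<ge> 0" for r
    by (intro bounded_measurable_integrable_on_cbox meas bdd that)
  have "integral unit_square (\<lambda>w. a (norm \<theta> * norm (f w))) = integral unit_square (\<lambda>w. a (1 * norm (f (w + \<tau>))))"
    by (rule integral_AE_cong) (use eq in \<open>eventually_elim, simp add: norm_mult\<close>)
  also have "\<dots> = integral unit_square (\<lambda>w. a (1 * norm (f w)))"
    by (intro integral_unit_square_translate meas bdd ae_periodic_compose [OF f(2), of "\<lambda>z. a (1 * norm z)"]) simp
  finally have "integral unit_square (\<lambda>w. a (norm \<theta> * norm (f w)) - a (1 * norm (f w))) = 0"
    by (subst integral_diff) (use int [of "norm \<theta>"] int [of 1] in auto)
  then have zero: "integral unit_square d = 0"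
    by (simp add: d_def [abs_def])
  have "AE w in lebesgue. w \<in> unit_square \<longrightarrow> d w = 0"
  proof (rule integral_unit_square_nonneg_zero_imp_AE [OF _ _ _ zero])
    show "d \<in> borel_measurable lebesgue"
      unfolding d_def using meas [of "norm \<theta>"] meas [of 1] by simp
    have "\<bar>d w\<bar> \<le> 1" for w
      using a01 [of "norm \<theta> * norm (f w)"] a01 [of "norm (f w)"] by (auto simp: d_def s_def abs_le_iff)
    then show "bounded (range d)" by (auto simp: bounded_iff)
    show "d w \<ge> 0" for w
    proof (cases "norm \<theta> > 1")
      case True
      then have "norm (f w) \<le> norm \<theta> * norm (f w)"
        using mult_right_mono [of 1 "norm \<theta>" "norm (f w)"] by simp
      then show ?thesis using True a_mono by (simp add: d_def s_def)
    next
      case False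
      then have "norm \<theta> * norm (f w) \<le> norm (f w)"
        using mult_right_mono [of "norm \<theta>" 1 "norm (f w)"] by simp
      then show ?thesis using False a_mono by (simp add: d_def s_def)
    qed
  qed
  moreover have "f w = 0" if "d w = 0" for w
  proof -
    have "s \<noteq> 0" by (simp add: s_def)
    then have "a (norm \<theta> * norm (f w)) = a (norm (f w))" using that by (simp add: d_def)
    then have "norm \<theta> * norm (f w) = norm (f w)" by (subst (asm) a_inj) auto
    then show ?thesis using ne by simp
  qed
  ultimately have "AE w in lebesgue. w \<in> unit_square \<longrightarrow> f w = 0" by (auto elim: eventually_mono)
  then show False
    using AE_eq_on_unit_square_imp_AE [OF f(2)] f(3) by blast
qed

text \<open>
  The translation by \<open>\<tau>\<close> multiplies the Fourier coefficient of \<open>h = squash f\<close> at \<open>k\<close> by the unimodular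
  number \<open>e2pi (zdot k \<tau>)\<close>, the eigenvalue equation multiplies it by \<open>\<theta>\<close>. Irrationality of \<open>\<tau>\<close>
  makes these numbers distinct, so \<open>h\<close> has a single nonzero coefficient and is a multiple of a
  character. Its modulus is constant, so \<open>f\<close> is a multiple of the same character.
\<close>

theorem rotation_eigenfunction_is_character:
  fixes f :: "real ^ 2 \<Rightarrow> complex"
  assumes f: "f \<in> borel_measurable lebesgue" "ae_periodic f" "\<not> (AE w in lebesgue. f w = 0)"
    and eq: "AE w in lebesgue. f (w + \<tau>) = \<theta> * f w"
    and irrational: "\<And>k. k \<noteq> 0 \<Longrightarrow> zdot k \<tau> \<notin> \<int>"
  obtains \<nu> b where "b \<noteq> 0" "\<theta> = e2pi (zdot \<nu> \<tau>)" "AE w in lebesgue. f w = b * e2pi (zdot \<nu> w)"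
proof -
  have \<theta>: "norm \<theta> = 1"
    by (rule rotation_eigenvalue_unimodular [OF f eq])
  define h where "h w = squash (f w)" for w
  have h: "h \<in> borel_measurable lebesgue" "bounded (range h)" "ae_periodic h"
    unfolding h_def
    by (rule squash_measurable [OF f(1)], rule bounded_squash, rule ae_periodic_compose [OF f(2)])
  have h_eq: "AE w in lebesgue. h (w + \<tau>) = \<theta> * h w"
    using eq by eventually_elim (simp add: h_def squash_mult_unimodular \<theta>)
  have coeff: "fourier_coeff h k = \<theta> * e2pi (- zdot k \<tau>) * fourier_coeff h k" for k
  proof -
    let ?u = "\<lambda>w. h w * e2pi (zdot (- k) w)"
    have u: "?u \<in> borel_measurable lebesgue" "bounded (range ?u)" "ae_periodic ?u"
      using h borel_measurable_character bounded_character
      by (auto intro: bounded_range_mult ae_periodic_times_character)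
    have "fourier_coeff h k = integral unit_square (\<lambda>w. ?u (w + \<tau>))"
      unfolding integral_unit_square_translate [OF u] by (simp add: fourier_coeff_def zdot_minus_left)
    also have "\<dots> = integral unit_square (\<lambda>w. \<theta> * e2pi (- zdot k \<tau>) * ?u w)"
      by (rule integral_AE_cong)
         (use h_eq in \<open>eventually_elim, simp add: zdot_add_right zdot_minus_left e2pi_diff e2pi_minus e2pi_add field_simps\<close>)
    also have "\<dots> = \<theta> * e2pi (- zdot k \<tau>) * fourier_coeff h k"
      by (simp add: fourier_coeff_def zdot_minus_left)
    finally show ?thesis .
  qed
  then have freq: "\<theta> = e2pi (zdot k \<tau>)" if "fourier_coeff h k \<noteq> 0" for k
  proof -
    have "\<theta> * e2pi (- zdot k \<tau>) = 1" using coeff [of k] that by simp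
    then show ?thesis by (simp add: e2pi_minus field_simps)
  qed
  have "\<not> fourier_null h"
  proof
    assume "fourier_null h"
    then have "AE w in lebesgue. h w = 0"
      using h(3) by (rule fourier_null_imp_AE_zero)
    then show False using f(3) by (simp add: h_def)
  qed
  then obtain \<nu> where \<nu>: "fourier_coeff h \<nu> \<noteq> 0"
    using h by (auto simp: fourier_null_def)
  define b where "b = fourier_coeff h \<nu>"
  have other: "fourier_coeff h k = 0" if "k \<noteq> \<nu>" for k
  proof (rule ccontr)
    assume "fourier_coeff h k \<noteq> 0"
    then have "zdot (k - \<nu>) \<tau> \<in> \<int>"
      using freq [of k] freq [OF \<nu>] by (simp add: zdot_diff_left e2pi_eq_iff [symmetric])
    then show False using irrational [of "k - \<nu>"] that by simp
  qed
  let ?r = "\<lambda>w. h w + (- b) * e2pi (zdot \<nu> w)"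
  have char: "(\<lambda>w. (- b) * e2pi (zdot \<nu> w)) \<in> borel_measurable lebesgue"
      "bounded (range (\<lambda>w. (- b) * e2pi (zdot \<nu> w)))"
    using borel_measurable_character by (auto simp: bounded_iff norm_mult)
  have "fourier_coeff ?r k = fourier_coeff h k - b * fourier_coeff (\<lambda>w. e2pi (zdot \<nu> w)) k" for k
  proof -
    have "fourier_coeff ?r k = integral unit_square (\<lambda>w. h w * e2pi (zdot (- k) w)
        + (- b) * (e2pi (zdot \<nu> w) * e2pi (zdot (- k) w)))"
      by (simp add: fourier_coeff_def zdot_minus_left algebra_simps)
    also have "\<dots> = integral unit_square (\<lambda>w. h w * e2pi (zdot (- k) w))
        + integral unit_square (\<lambda>w. (- b) * (e2pi (zdot \<nu> w) * e2pi (zdot (- k) w)))"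
      by (intro integral_add integrable_on_mult_right integrable_times_character h
          borel_measurable_character bounded_character)
    also have "\<dots> = fourier_coeff h k - b * fourier_coeff (\<lambda>w. e2pi (zdot \<nu> w)) k"
      by (simp add: fourier_coeff_def zdot_minus_left)
    finally show ?thesis .
  qed
  then have "fourier_coeff ?r k = 0" for k
    using other [of k] by (auto simp: fourier_coeff_character b_def)
  then have "fourier_null ?r"
    unfolding fourier_null_def
    using borel_measurable_add [OF h(1) char(1)] bounded_range_add [OF h(2) char(2)] by blast
  moreover have "ae_periodic ?r"
  proof -
    have "AE w in lebesgue. ?r (w + axis j 1) = ?r w" for j
      using h(3) [unfolded ae_periodic_def, rule_format, of j]
      by eventually_elim (simp add: zdot_add_right zdot_axis e2pi_add)
    then show ?thesis by (simp add: ae_periodic_def)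
  qed
  ultimately have "AE w in lebesgue. ?r w = 0"
    by (rule fourier_null_imp_AE_zero)
  then have hb: "AE w in lebesgue. h w = b * e2pi (zdot \<nu> w)"
    by eventually_elim (simp add: algebra_simps)
  have "AE w in lebesgue. f w = b / of_real (1 - norm b) * e2pi (zdot \<nu> w)"
    using hb
  proof eventually_elim
    case (elim w)
    then have "norm (squash (f w)) = norm b" by (simp add: h_def norm_mult)
    then show ?case
      using unsquash [of "f w"] elim by (simp add: h_def)
  qed
  moreover from this have "b / of_real (1 - norm b) \<noteq> 0"
    using f(3) by auto
  ultimately show thesis
    using that freq [OF \<nu>] by blast
qed

section \<open>Sections carried by a line\<close>

lemma hinner_scale_right: "hinner x (c *s y) = c * hinner x y"
  by (simp add: hinner_def sum_distrib_left mult_ac)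

lemma hinner_scale_left: "hinner (c *s x) y = cnj c * hinner x y"
  by (simp add: hinner_def sum_distrib_left mult_ac)

lemma hinner_self_nonzero:
  fixes x :: "complex ^ 'n"
  assumes "x \<noteq> 0"
  shows "hinner x x \<noteq> 0"
proof -
  have "hinner x x = of_real (\<Sum>i\<in>UNIV. (norm (x $ i))\<^sup>2)"
    by (simp add: hinner_def mult.commute flip: complex_norm_square)
  moreover have "(\<Sum>i\<in>UNIV. (norm (x $ i))\<^sup>2) \<noteq> 0"
    using assms by (simp add: sum_nonneg_eq_0_iff vec_eq_iff)
  ultimately show ?thesis by (simp only: of_real_eq_0_iff not_False_eq_True)
qed

lemma norm_vector_scalar_mult:
  fixes x :: "complex ^ 'n"
  shows "norm (c *s x) = norm c * norm x"
  by (simp add: norm_vec_def norm_mult L2_set_right_distrib)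

lemma line_spanned:
  fixes x :: "complex ^ 'n"
  assumes "L \<in> lines" "x \<in> L" "x \<noteq> 0" "y \<in> L"
  obtains c where "y = c *s x"
proof -
  have "L \<subseteq> vec.span {x}"
    using assms by (intro vec.card_ge_dim_independent) (auto simp: lines_def vec.independent_insert)
  then show thesis
    using assms(4) that by (auto simp: vec.span_singleton)
qed

lemma line_coordinate:
  fixes x :: "complex ^ 'n"
  assumes "L \<in> lines" "x \<in> L" "x \<noteq> 0" "y \<in> L"
  shows "y = (hinner x y / hinner x x) *s x"
proof -
  obtain c where "y = c *s x" using line_spanned [OF assms] .
  then show ?thesis
    using hinner_self_nonzero [OF assms(3)] by (simp add: hinner_scale_right)
qed

lemma invariant_line_in_lines: "invariant_line U A \<tau> l \<Longrightarrow> l w \<in> lines"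
  using continuous_map_image_subset_topspace [of euclidean projective_space l]
  by (auto simp: invariant_line_def topspace_projective_space)

lemma invariant_line_scale: "invariant_line U A \<tau> l \<Longrightarrow> v \<in> l w \<Longrightarrow> c *s v \<in> l w"
  using invariant_line_in_lines [of U A \<tau> l w] by (auto simp: lines_def intro: vec.subspace_scale)

lemma borel_measurable_vector_scalar_mult:
  fixes F :: "'a \<Rightarrow> complex ^ 'n"
  assumes "f \<in> borel_measurable M" "F \<in> borel_measurable M"
  shows "(\<lambda>w. f w *s F w) \<in> borel_measurable M"
proof (rule borel_measurable_continuous_Pair [OF assms])
  show "continuous_on UNIV (\<lambda>x::complex \<times> (complex ^ 'n). fst x *s snd x)"
    unfolding vector_scalar_mult_def by (intro continuous_intros)
qed

lemma borel_measurable_hinner: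
  fixes F G :: "'a \<Rightarrow> complex ^ 'n"
  assumes "F \<in> borel_measurable M" "G \<in> borel_measurable M"
  shows "(\<lambda>w. hinner (F w) (G w)) \<in> borel_measurable M"
proof (rule borel_measurable_continuous_Pair [OF assms])
  show "continuous_on UNIV (\<lambda>x::(complex ^ 'n) \<times> (complex ^ 'n). hinner (fst x) (snd x))"
    unfolding hinner_def by (intro continuous_intros)
qed

lemma measurable_section_character:
  assumes "measurable_section U F"
  shows "measurable_section U (twist_section \<nu> F)"
  unfolding measurable_section_def
proof
  show "twist_section \<nu> F \<in> borel_measurable lebesgue"
    unfolding twist_section_def [abs_def]
    using assms borel_measurable_character
    by (intro borel_measurable_vector_scalar_mult) (auto simp: measurable_section_def)
  show "\<forall>j. AE w in lebesgue. twist_section \<nu> F (w + axis j 1) = U j w *v twist_section \<nu> F w"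
  proof
    fix j
    have "AE w in lebesgue. F (w + axis j 1) = U j w *v F w"
      using assms by (simp add: measurable_section_def)
    then show "AE w in lebesgue. twist_section \<nu> F (w + axis j 1) = U j w *v twist_section \<nu> F w"
      by eventually_elim (simp add: twist_section_def zdot_add_right zdot_axis e2pi_add vector_scalar_commute)
  qed
qed

lemma twist_eigensection:
  assumes "eigensection U A \<tau> F \<eta>"
  shows "eigensection U A \<tau> (twist_section \<nu> F) (twist_eigenvalue \<tau> \<nu> \<eta>)"
  unfolding eigensection_def
proof (intro conjI)
  show "measurable_section U (twist_section \<nu> F)"
    using assms by (intro measurable_section_character) (simp add: eigensection_def)
  show "\<not> (AE w in lebesgue. twist_section \<nu> F w = 0)"
    using assms by (simp add: eigensection_def twist_section_def)
  have "AE w in lebesgue. A w *v F w = \<eta> *s F (w + \<tau>)"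
    using assms by (simp add: eigensection_def)
  then show "AE w in lebesgue. A w *v twist_section \<nu> F w
      = twist_eigenvalue \<tau> \<nu> \<eta> *s twist_section \<nu> F (w + \<tau>)"
    by eventually_elim
       (simp add: twist_section_def twist_eigenvalue_def zdot_add_right e2pi_add e2pi_minus
          vector_scalar_commute)
qed

lemma carried_by_scale:
  assumes "invariant_line U A \<tau> l" "carried_by l F"
  shows "carried_by l (\<lambda>w. c w *s F w)"
  using assms(2) unfolding carried_by_def
  by eventually_elim (rule invariant_line_scale [OF assms(1)])

lemma carried_by_twist:
  "invariant_line U A \<tau> l \<Longrightarrow> carried_by l F \<Longrightarrow> carried_by l (twist_section \<nu> F)"
  unfolding twist_section_def [abs_def] by (rule carried_by_scale)

text \<open>
  Eigenspaces are closed under scalar multiples and a.e. changes, which the condition of not vanishing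
  almost everywhere would spoil.
\<close>

lemma eigensection_carried_iff:
  "eigensection U A \<tau> F \<eta> \<and> carried_by l F \<longleftrightarrow>
     F \<in> line_eigenspace U A \<tau> l \<eta> \<and> \<not> (AE w in lebesgue. F w = 0)"
  by (auto simp: eigensection_def line_eigenspace_def)

lemma line_eigenspace_scale:
  assumes l: "invariant_line U A \<tau> l" and F: "F \<in> line_eigenspace U A \<tau> l \<eta>"
    and G: "G \<in> borel_measurable lebesgue" "AE w in lebesgue. G w = c *s F w"
  shows "G \<in> line_eigenspace U A \<tau> l \<eta>"
proof -
  have "AE w in lebesgue. G (w + axis j 1) = U j w *v G w" for j
  proof -
    have "AE w in lebesgue. F (w + axis j 1) = U j w *v F w"
      using F by (simp add: line_eigenspace_def measurable_section_def)
    with G(2) AE_lebesgue_translation [OF G(2), of "axis j 1"] show ?thesis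
      by eventually_elim (simp add: vector_scalar_commute)
  qed
  moreover have "AE w in lebesgue. A w *v G w = \<eta> *s G (w + \<tau>)"
  proof -
    have "AE w in lebesgue. A w *v F w = \<eta> *s F (w + \<tau>)"
      using F by (simp add: line_eigenspace_def)
    with G(2) AE_lebesgue_translation [OF G(2), of \<tau>] show ?thesis
      by eventually_elim (simp add: vector_scalar_commute mult.commute)
  qed
  moreover have "carried_by l G"
  proof -
    have "AE w in lebesgue. F w \<in> l w"
      using F by (simp add: line_eigenspace_def carried_by_def)
    with G(2) show ?thesis
      unfolding carried_by_def by eventually_elim (simp add: invariant_line_scale [OF l])
  qed
  ultimately show ?thesis
    using G(1) by (simp add: line_eigenspace_def measurable_section_def)
qed

text \<open>
  \<open>F\<close> and \<open>F0\<close> satisfy the same equivariance equations and \<open>F0\<close> vanishes nowhere, so the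
  coefficients of \<open>F0 (w + axis j 1)\<close> and \<open>F0 (w + \<tau>)\<close> on both sides may be compared.
\<close>

lemma eigensection_ratio:
  assumes l: "invariant_line U A \<tau> l"
    and F0: "F0 \<in> line_eigenspace U A \<tau> l \<eta>0" "\<And>w. F0 w \<in> l w" "\<And>w. F0 w \<noteq> 0"
    and F: "F \<in> line_eigenspace U A \<tau> l \<eta>"
  obtains f where "f \<in> borel_measurable lebesgue" "ae_periodic f"
    "AE w in lebesgue. F w = f w *s F0 w" "AE w in lebesgue. \<eta> * f (w + \<tau>) = \<eta>0 * f w"
proof
  define f where "f w = hinner (F0 w) (F w) / hinner (F0 w) (F0 w)" for w
  have meas: "F0 \<in> borel_measurable lebesgue" "F \<in> borel_measurable lebesgue"
    using F0(1) F by (auto simp: line_eigenspace_def measurable_section_def)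
  show "f \<in> borel_measurable lebesgue"
    unfolding f_def using borel_measurable_hinner [OF meas] borel_measurable_hinner [OF meas(1) meas(1)]
    by measurable
  have "AE w in lebesgue. F w \<in> l w"
    using F by (simp add: line_eigenspace_def carried_by_def)
  then show eq: "AE w in lebesgue. F w = f w *s F0 w"
    by eventually_elim (simp add: f_def line_coordinate [OF invariant_line_in_lines [OF l] F0(2,3)])
  note shifted = AE_lebesgue_translation [OF eq]
  show "ae_periodic f"
    unfolding ae_periodic_def
  proof
    fix j
    have "AE w in lebesgue. F (w + axis j 1) = U j w *v F w"
        "AE w in lebesgue. F0 (w + axis j 1) = U j w *v F0 w"
      using F F0(1) by (auto simp: line_eigenspace_def measurable_section_def)
    with eq shifted [of "axis j 1"] show "AE w in lebesgue. f (w + axis j 1) = f w"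
    proof eventually_elim
      case (elim w)
      then have "f (w + axis j 1) *s F0 (w + axis j 1) = f w *s F0 (w + axis j 1)"
        by (metis vector_scalar_commute)
      then show ?case using F0(3) [of "w + axis j 1"] by (metis vector_mul_rcancel)
    qed
  qed
  have "AE w in lebesgue. A w *v F w = \<eta> *s F (w + \<tau>)"
      "AE w in lebesgue. A w *v F0 w = \<eta>0 *s F0 (w + \<tau>)"
    using F F0(1) by (auto simp: line_eigenspace_def)
  with eq shifted [of \<tau>] show "AE w in lebesgue. \<eta> * f (w + \<tau>) = \<eta>0 * f w"
  proof eventually_elim
    case (elim w)
    have "(\<eta> * f (w + \<tau>)) *s F0 (w + \<tau>) = \<eta> *s F (w + \<tau>)"
      unfolding elim(2) by simp
    also have "\<dots> = A w *v (f w *s F0 w)"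
      using elim(1,3) by metis
    also have "\<dots> = (\<eta>0 * f w) *s F0 (w + \<tau>)"
      by (simp add: vector_scalar_commute elim(4) mult.commute)
    finally have "(\<eta> * f (w + \<tau>)) *s F0 (w + \<tau>) = (\<eta>0 * f w) *s F0 (w + \<tau>)" .
    then show ?case using F0(3) [of "w + \<tau>"] by (metis vector_mul_rcancel)
  qed
qed

lemma carried_eigensection_is_twist:
  assumes l: "invariant_line U A \<tau> l"
    and F0: "F0 \<in> line_eigenspace U A \<tau> l \<eta>0" "\<And>w. F0 w \<in> l w" "\<And>w. F0 w \<noteq> 0"
    and \<eta>0: "\<eta>0 \<noteq> 0"
    and irrational: "\<And>k. k \<noteq> 0 \<Longrightarrow> zdot k \<tau> \<notin> \<int>"
    and F: "F \<in> line_eigenspace U A \<tau> l \<eta>" "\<not> (AE w in lebesgue. F w = 0)"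
  obtains \<nu> b where "b \<noteq> 0" "\<eta> = twist_eigenvalue \<tau> \<nu> \<eta>0"
    "AE w in lebesgue. F w = b *s twist_section \<nu> F0 w"
proof -
  obtain f where f: "f \<in> borel_measurable lebesgue" "ae_periodic f"
    and Ff: "AE w in lebesgue. F w = f w *s F0 w"
    and eq: "AE w in lebesgue. \<eta> * f (w + \<tau>) = \<eta>0 * f w"
    using eigensection_ratio [OF l F0 F(1)] .
  have f0: "\<not> (AE w in lebesgue. f w = 0)"
  proof
    assume "AE w in lebesgue. f w = 0"
    with Ff have "AE w in lebesgue. F w = 0" by eventually_elim simp
    then show False using F(2) by simp
  qed
  have "\<eta> \<noteq> 0"
    using eq f0 \<eta>0 by auto
  have "AE w in lebesgue. f (w + \<tau>) = \<eta>0 / \<eta> * f w"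
    using eq by eventually_elim (use \<open>\<eta> \<noteq> 0\<close> in \<open>simp add: field_simps\<close>)
  from rotation_eigenfunction_is_character [OF f f0 this irrational]
  obtain \<nu> b where b: "b \<noteq> 0" "\<eta>0 / \<eta> = e2pi (zdot \<nu> \<tau>)"
      "AE w in lebesgue. f w = b * e2pi (zdot \<nu> w)"
    by blast
  show thesis
  proof (rule that [OF b(1)])
    show "\<eta> = twist_eigenvalue \<tau> \<nu> \<eta>0"
      using b(2) \<open>\<eta> \<noteq> 0\<close> by (simp add: twist_eigenvalue_def e2pi_minus field_simps)
    show "AE w in lebesgue. F w = b *s twist_section \<nu> F0 w"
      using Ff b(3) by eventually_elim (simp add: twist_section_def)
  qed
qed

section \<open>The set of eigenvalues\<close>

lemma diophantine_imp_irrational: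
  assumes "diophantine c d \<tau>" "c > 0" "k \<noteq> 0"
  shows "zdot k \<tau> \<notin> \<int>"
proof
  assume "zdot k \<tau> \<in> \<int>"
  then have "dist_to_int (zdot k \<tau>) = 0"
    by (auto simp: dist_to_int_def elim: Ints_cases)
  moreover have "\<bar>k $ 1\<bar> + \<bar>k $ 2\<bar> > 0"
    using assms(3) by (auto simp: vec_eq_iff forall_2)
  then have "c * of_int (\<bar>k $ 1\<bar> + \<bar>k $ 2\<bar>) powr (- d) > 0"
    using assms(2) by (intro mult_pos_pos) (auto simp del: of_int_add of_int_abs)
  ultimately show False
    using assms(1,3) unfolding diophantine_def by (metis not_le)
qed

lemma twist_eigenvalue_inject:
  assumes "\<eta> \<noteq> 0" "\<And>k. k \<noteq> 0 \<Longrightarrow> zdot k \<tau> \<notin> \<int>"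
  shows "twist_eigenvalue \<tau> \<mu> \<eta> = twist_eigenvalue \<tau> \<nu> \<eta> \<longleftrightarrow> \<mu> = \<nu>"
  using assms(1) assms(2) [of "\<nu> - \<mu>"]
  by (auto simp: twist_eigenvalue_def e2pi_eq_iff zdot_diff_left)

lemma norm_twist_eigenvalue: "norm (twist_eigenvalue \<tau> \<nu> \<eta>) = norm \<eta>"
  by (simp add: twist_eigenvalue_def norm_mult)

text \<open>
  The twists by multiples of the first coordinate character are enough: they multiply the eigenvalue by
  \<open>e2pi (- (of_int n * \<tau> $ 1))\<close>, and \<open>\<tau> $ 1\<close> is irrational.
\<close>

lemma twist_eigenvalues_dense:
  assumes irrational: "\<And>k. k \<noteq> 0 \<Longrightarrow> zdot k \<tau> \<notin> \<int>"
  shows "sphere 0 (norm \<eta>) \<subseteq> closure (range (\<lambda>\<nu>. twist_eigenvalue \<tau> \<nu> \<eta>))"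
proof
  fix z :: complex assume "z \<in> sphere 0 (norm \<eta>)"
  then have z: "norm z = norm \<eta>" by simp
  have mult: "zdot (axis 1 n) \<tau> = of_int n * \<tau> $ 1" for n
    by (simp add: zdot_alt axis_def)
  have "\<tau> $ 1 \<notin> \<rat>"
  proof
    assume "\<tau> $ 1 \<in> \<rat>"
    then obtain p q :: int where "q > 0" "\<tau> $ 1 = of_int p / of_int q"
      by (metis Rats_cases')
    then have "zdot (axis 1 q) \<tau> \<in> \<int>" "axis 1 q \<noteq> (0 :: int ^ 2)"
      by (auto simp: mult axis_eq_0_iff)
    then show False using irrational by blast
  qed
  show "z \<in> closure (range (\<lambda>\<nu>. twist_eigenvalue \<tau> \<nu> \<eta>))"
  proof (cases "\<eta> = 0")
    case True
    then show ?thesis using z closure_subset by (fastforce simp: twist_eigenvalue_def)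
  next
    case False
    define s where "s = Arg (z / \<eta>) / (2 * pi)"
    have "z / \<eta> \<noteq> 0" using False z by auto
    then have "z / \<eta> = e2pi s"
      using False z Arg_eq [of "z / \<eta>"] by (simp add: s_def e2pi_def norm_divide mult_ac)
    then have zs: "z = \<eta> * e2pi s" using False by (simp add: field_simps)
    show ?thesis
      unfolding closure_approachable
    proof (intro allI impI)
      fix \<epsilon> :: real assume "\<epsilon> > 0"
      have "isCont (\<lambda>x. \<eta> * e2pi (s + x)) 0"
        unfolding e2pi_def by (intro continuous_intros)
      then obtain \<delta> where \<delta>: "\<delta> > 0" "\<And>x. \<bar>x\<bar> < \<delta> \<Longrightarrow> dist (\<eta> * e2pi (s + x)) z < \<epsilon>"
        using \<open>\<epsilon> > 0\<close> zs unfolding continuous_at_eps_delta by (auto simp: dist_real_def)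
      obtain h k where hk: "\<bar>of_int k * \<tau> $ 1 - of_int h - (- s)\<bar> < \<delta>"
        using sequence_of_fractional_parts_is_dense [OF \<open>\<tau> $ 1 \<notin> \<rat>\<close> \<delta>(1)] by metis
      let ?x = "- (of_int k * \<tau> $ 1 - of_int h - (- s))"
      have "e2pi (s + ?x) = e2pi (- (of_int k * \<tau> $ 1))"
        by (subst e2pi_eq_iff) simp
      then have "twist_eigenvalue \<tau> (axis 1 k) \<eta> = \<eta> * e2pi (s + ?x)"
        by (simp add: twist_eigenvalue_def mult)
      then show "\<exists>y\<in>range (\<lambda>\<nu>. twist_eigenvalue \<tau> \<nu> \<eta>). dist y z < \<epsilon>"
        using \<delta>(2) [of ?x] hk by (metis abs_minus_cancel rangeI)
    qed
  qed
qed

text \<open>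
  Two unit sections of a line differ by unimodular factors, which leave the modulus of the multiplier
  unchanged. This makes the definite description in the Lyapunov exponent well defined.
\<close>

lemma log_multiplier_unique:
  assumes l: "invariant_line U A \<tau> l"
    and e: "normalized_unit_section U l e" "normalized_unit_section U l e'"
  shows "log_multiplier A \<tau> e' = log_multiplier A \<tau> e"
proof
  fix w
  have props: "norm (e w) = 1" "e w \<in> l w" "norm (e' w) = 1" "e' w \<in> l w" for w
    using e by (auto simp: normalized_unit_section_def unit_section_charge_def)
  have "\<exists>c. norm c = 1 \<and> e' w = c *s e w" for w
  proof -
    have "e w \<noteq> 0" using props(1) [of w] by auto
    then obtain c where "e' w = c *s e w"
      using line_spanned [OF invariant_line_in_lines [OF l] props(2) _ props(4)] by blast
    then show ?thesis
      using props(1,3) [of w] by (auto simp: norm_vector_scalar_mult)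
  qed
  then obtain c where c: "\<And>w. norm (c w) = 1" "\<And>w. e' w = c w *s e w" by metis
  show "log_multiplier A \<tau> e' w = log_multiplier A \<tau> e w"
    by (simp add: log_multiplier_def multiplier_def c vector_scalar_commute
        hinner_scale_left hinner_scale_right norm_mult)
qed

lemma line_lyapunov_exponent_eq:
  assumes "invariant_line U A \<tau> l" "normalized_unit_section U l e"
  shows "line_lyapunov_exponent U A \<tau> l = torus_mean (log_multiplier A \<tau> e)"
  unfolding line_lyapunov_exponent_def
proof (rule the_equality)
  show "\<exists>e'. normalized_unit_section U l e'
      \<and> torus_mean (log_multiplier A \<tau> e) = torus_mean (log_multiplier A \<tau> e')"
    using assms(2) by blast
  fix x assume "\<exists>e'. normalized_unit_section U l e' \<and> x = torus_mean (log_multiplier A \<tau> e')"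
  then show "x = torus_mean (log_multiplier A \<tau> e)"
    using log_multiplier_unique [OF assms] by auto
qed

lemma real_analytic_of_real_cmult:
  "real_analytic v \<Longrightarrow> real_analytic (\<lambda>w. c * complex_of_real (v w))"
  by (rule real_analytic_linear [where T = "\<lambda>x. c * complex_of_real x"])
     (intro bounded_linear_const_mult bounded_linear_of_real)

text \<open>
  The twisting character is the exponential of a linear function, so it can be merged with the
  exponential that defines \<open>F\<close>.
\<close>

lemma explicit_twist_analytic:
  assumes "explicit_eigensection U A \<tau> l F \<eta>"
  shows "real_analytic (\<lambda>w. b *s twist_section \<nu> F w)"
proof -
  obtain e v1 v2 where an: "real_analytic e" "real_analytic v1" "real_analytic v2"
    and F: "F = (\<lambda>w. exp (- (of_real (v1 w) + 2 * of_real pi * \<i> * of_real (v2 w))) *s e w)"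
    using assms unfolding explicit_eigensection_def by blast
  let ?\<Phi> = "\<lambda>w. (- 1) * complex_of_real (v1 w) + (- (2 * of_real pi * \<i>)) * complex_of_real (v2 w)
    + (2 * of_real pi * \<i>) * complex_of_real (zdot \<nu> w)"
  have eq: "(\<lambda>w. b *s twist_section \<nu> F w) = (\<lambda>w. (b * exp (?\<Phi> w)) *s e w)"
    by (simp add: fun_eq_iff F twist_section_def e2pi_def exp_add [symmetric] mult.assoc add_ac)
  have "real_analytic (\<lambda>w. (b * exp (?\<Phi> w)) *s e w)"
    by (intro real_analytic_vec_mult real_analytic_mult real_analytic_const real_analytic_exp
        real_analytic_add real_analytic_of_real_cmult real_analytic_zdot an)
  then show ?thesis
    by (simp only: eq)
qed

section \<open>Classification of the eigensections carried by the line\<close>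

theorem theorem9p5:
  fixes U :: "2 \<Rightarrow> real ^ 2 \<Rightarrow> complex ^ 'n ^ 'n"
    and A :: "real ^ 2 \<Rightarrow> complex ^ 'n ^ 'n"
    and \<tau> :: "real ^ 2"
    and l :: "real ^ 2 \<Rightarrow> (complex ^ 'n) set"
    and F0 :: "real ^ 2 \<Rightarrow> complex ^ 'n"
    and \<eta>0 :: complex
  assumes "sewing_system U"
    and "equivariant_cocycle U A \<tau>"
    and "invariant_line U A \<tau> l"
    and "eigensection U A \<tau> F0 \<eta>0"
    and "carried_by l F0"
  shows "(\<forall>\<nu>. eigensection U A \<tau> (twist_section \<nu> F0) (twist_eigenvalue \<tau> \<nu> \<eta>0) \<and>
              carried_by l (twist_section \<nu> F0)) \<and>
         (\<forall>ls lu. \<forall>c d :: real.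
            CARD('n) = 2 \<and> strip_admissible U A \<tau> \<and>
            dominated_splitting U A \<tau> ls lu \<and>
            c > 0 \<and> d \<ge> 1 \<and> diophantine c d \<tau> \<and>
            (l = ls \<or> l = lu) \<and>
            charge U l = 0 \<and> line_winding U A \<tau> l = 0 \<and>
            explicit_eigensection U A \<tau> l F0 \<eta>0
            \<longrightarrow>
              (\<forall>F \<eta>. eigensection U A \<tau> F \<eta> \<and> carried_by l F \<longrightarrow>
                 (\<exists>!\<nu>. \<eta> = twist_eigenvalue \<tau> \<nu> \<eta>0 \<and>
                    (\<exists>b. b \<noteq> 0 \<and> (AE w in lebesgue. F w = b *s twist_section \<nu> F0 w)))) \<and>
              realised_eigenvalues U A \<tau> l = {\<eta>0 * e2pi (- zdot \<nu> \<tau>) | \<nu>. True} \<and>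
              realised_eigenvalues U A \<tau> l \<subseteq> sphere 0 (exp (line_lyapunov_exponent U A \<tau> l)) \<and>
              sphere 0 (exp (line_lyapunov_exponent U A \<tau> l)) \<subseteq> closure (realised_eigenvalues U A \<tau> l) \<and>
              (\<forall>\<eta>\<in>realised_eigenvalues U A \<tau> l. ae_one_dimensional (line_eigenspace U A \<tau> l \<eta>)) \<and>
              (\<forall>F \<eta>. eigensection U A \<tau> F \<eta> \<and> carried_by l F \<longrightarrow>
                 (\<exists>G. eigensection U A \<tau> G \<eta> \<and> carried_by l G \<and>
                    real_analytic G \<and> (\<forall>w. G w \<noteq> 0) \<and>
                    (AE w in lebesgue. F w = G w))))"
proof (intro conjI allI impI)
  fix \<nu>
  show "eigensection U A \<tau> (twist_section \<nu> F0) (twist_eigenvalue \<tau> \<nu> \<eta>0)"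
    by (rule twist_eigensection [OF assms(4)])
  show "carried_by l (twist_section \<nu> F0)"
    by (rule carried_by_twist [OF assms(3,5)])
next
  fix ls lu and c d :: real
  assume hyps: "CARD('n) = 2 \<and> strip_admissible U A \<tau> \<and>
            dominated_splitting U A \<tau> ls lu \<and>
            c > 0 \<and> d \<ge> 1 \<and> diophantine c d \<tau> \<and>
            (l = ls \<or> l = lu) \<and>
            charge U l = 0 \<and> line_winding U A \<tau> l = 0 \<and>
            explicit_eigensection U A \<tau> l F0 \<eta>0"
  note l = assms(3)
  have irrational: "zdot k \<tau> \<notin> \<int>" if "k \<noteq> 0" for k
    using hyps that diophantine_imp_irrational [of c d \<tau> k] by simp
  have explicit: "explicit_eigensection U A \<tau> l F0 \<eta>0"
    using hyps by blast
  then obtain e g v1 v2 where e: "normalized_unit_section U l e"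
    and F0_eq: "F0 = (\<lambda>w. exp (- (of_real (v1 w) + 2 * of_real pi * \<i> * of_real (v2 w))) *s e w)"
    and \<eta>0_eq: "\<eta>0 = of_real (exp (torus_mean (log_multiplier A \<tau> e))) * e2pi (torus_mean g)"
    unfolding explicit_eigensection_def by blast
  have F0_line: "F0 w \<in> l w" and F0_nonzero: "F0 w \<noteq> 0" for w
  proof -
    have "e w \<in> l w" "norm (e w) = 1"
      using e by (auto simp: normalized_unit_section_def unit_section_charge_def)
    then show "F0 w \<in> l w" "F0 w \<noteq> 0"
      unfolding F0_eq using invariant_line_scale [OF l] by auto
  qed
  have \<eta>0_norm: "norm \<eta>0 = exp (line_lyapunov_exponent U A \<tau> l)"
    unfolding line_lyapunov_exponent_eq [OF l e] \<eta>0_eq by (simp add: norm_mult)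
  then have \<eta>0: "\<eta>0 \<noteq> 0" by auto
  have F0: "F0 \<in> line_eigenspace U A \<tau> l \<eta>0"
    using assms(4,5) eigensection_carried_iff by blast
  have inj: "twist_eigenvalue \<tau> \<mu> \<eta>0 = twist_eigenvalue \<tau> \<nu> \<eta>0 \<longleftrightarrow> \<mu> = \<nu>" for \<mu> \<nu>
    by (rule twist_eigenvalue_inject [OF \<eta>0 irrational])
  have twist: "eigensection U A \<tau> (twist_section \<nu> F0) (twist_eigenvalue \<tau> \<nu> \<eta>0)"
      "carried_by l (twist_section \<nu> F0)" for \<nu>
    by (rule twist_eigensection [OF assms(4)], rule carried_by_twist [OF l assms(5)])
  have classify: "\<exists>\<nu> b. b \<noteq> 0 \<and> \<eta> = twist_eigenvalue \<tau> \<nu> \<eta>0 \<and>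
      (AE w in lebesgue. F w = b *s twist_section \<nu> F0 w)"
    if "eigensection U A \<tau> F \<eta>" "carried_by l F" for F \<eta>
  proof -
    have "F \<in> line_eigenspace U A \<tau> l \<eta>" "\<not> (AE w in lebesgue. F w = 0)"
      using that eigensection_carried_iff by blast+
    from carried_eigensection_is_twist [OF l F0 F0_line F0_nonzero \<eta>0 irrational this]
    show ?thesis by blast
  qed
  have realised: "realised_eigenvalues U A \<tau> l = range (\<lambda>\<nu>. twist_eigenvalue \<tau> \<nu> \<eta>0)"
    unfolding realised_eigenvalues_def using classify twist by blast
  show "\<exists>!\<nu>. \<eta> = twist_eigenvalue \<tau> \<nu> \<eta>0 \<and>
          (\<exists>b. b \<noteq> 0 \<and> (AE w in lebesgue. F w = b *s twist_section \<nu> F0 w))"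
    if "eigensection U A \<tau> F \<eta> \<and> carried_by l F" for F \<eta>
  proof -
    obtain \<nu> b where \<nu>: "b \<noteq> 0" "\<eta> = twist_eigenvalue \<tau> \<nu> \<eta>0"
        "AE w in lebesgue. F w = b *s twist_section \<nu> F0 w"
      using classify \<open>eigensection U A \<tau> F \<eta> \<and> carried_by l F\<close> by blast
    show ?thesis
    proof (rule ex1I [of _ \<nu>])
      show "\<eta> = twist_eigenvalue \<tau> \<nu> \<eta>0 \<and>
          (\<exists>b. b \<noteq> 0 \<and> (AE w in lebesgue. F w = b *s twist_section \<nu> F0 w))"
        using \<nu> by blast
    qed (use \<nu>(2) inj in auto)
  qed
  show "realised_eigenvalues U A \<tau> l = {\<eta>0 * e2pi (- zdot \<nu> \<tau>) | \<nu>. True}"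
    unfolding realised twist_eigenvalue_def by blast
  show "realised_eigenvalues U A \<tau> l \<subseteq> sphere 0 (exp (line_lyapunov_exponent U A \<tau> l))"
    unfolding realised by (auto simp: norm_twist_eigenvalue \<eta>0_norm)
  show "sphere 0 (exp (line_lyapunov_exponent U A \<tau> l)) \<subseteq> closure (realised_eigenvalues U A \<tau> l)"
    unfolding realised \<eta>0_norm [symmetric] by (rule twist_eigenvalues_dense [OF irrational])
  show "\<forall>\<eta>\<in>realised_eigenvalues U A \<tau> l. ae_one_dimensional (line_eigenspace U A \<tau> l \<eta>)"
  proof
    fix \<eta> assume "\<eta> \<in> realised_eigenvalues U A \<tau> l"
    then obtain \<nu> where \<nu>: "\<eta> = twist_eigenvalue \<tau> \<nu> \<eta>0"
      unfolding realised by blast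
    let ?F = "twist_section \<nu> F0" and ?E = "line_eigenspace U A \<tau> l \<eta>"
    have F: "?F \<in> ?E" "\<not> (AE w in lebesgue. ?F w = 0)"
      using twist eigensection_carried_iff unfolding \<nu> by blast+
    have "?E = {G \<in> borel_measurable lebesgue. \<exists>c. AE w in lebesgue. G w = c *s ?F w}"
    proof (intro set_eqI iffI)
      fix G assume G: "G \<in> ?E"
      have "\<exists>c. AE w in lebesgue. G w = c *s ?F w"
      proof (cases "AE w in lebesgue. G w = 0")
        case True
        then show ?thesis by (intro exI [of _ 0]) simp
      next
        case False
        then obtain \<mu> b where \<mu>: "\<eta> = twist_eigenvalue \<tau> \<mu> \<eta>0"
            "AE w in lebesgue. G w = b *s twist_section \<mu> F0 w"
          using G classify [of G \<eta>] eigensection_carried_iff [of U A \<tau> G \<eta> l] by blast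
        have "\<mu> = \<nu>" using inj \<mu>(1) \<nu> by simp
        then have "AE w in lebesgue. G w = b *s ?F w" using \<mu>(2) by (simp only:)
        then show ?thesis by (rule exI)
      qed
      then show "G \<in> {G \<in> borel_measurable lebesgue. \<exists>c. AE w in lebesgue. G w = c *s ?F w}"
        using G by (auto simp: line_eigenspace_def measurable_section_def)
    next
      fix G assume "G \<in> {G \<in> borel_measurable lebesgue. \<exists>c. AE w in lebesgue. G w = c *s ?F w}"
      then show "G \<in> ?E"
        using line_eigenspace_scale [OF l F(1)] by blast
    qed
    then show "ae_one_dimensional ?E"
      unfolding ae_one_dimensional_def using F by blast
  qed
  show "\<exists>G. eigensection U A \<tau> G \<eta> \<and> carried_by l G \<and> real_analytic G \<and> (\<forall>w. G w \<noteq> 0) \<and>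
          (AE w in lebesgue. F w = G w)"
    if F: "eigensection U A \<tau> F \<eta> \<and> carried_by l F" for F \<eta>
  proof -
    obtain \<nu> b where b: "b \<noteq> 0" "\<eta> = twist_eigenvalue \<tau> \<nu> \<eta>0"
        "AE w in lebesgue. F w = b *s twist_section \<nu> F0 w"
      using classify F by blast
    let ?G = "\<lambda>w. b *s twist_section \<nu> F0 w"
    have "twist_section \<nu> F0 \<in> line_eigenspace U A \<tau> l \<eta>"
      using twist eigensection_carried_iff unfolding b(2) by blast
    moreover have "?G \<in> borel_measurable lebesgue"
      using twist(1) [of \<nu>]
      by (intro borel_measurable_vector_scalar_mult)
         (auto simp: eigensection_def measurable_section_def)
    ultimately have "?G \<in> line_eigenspace U A \<tau> l \<eta>"
      by (rule line_eigenspace_scale [OF l, where c = b]) simp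
    moreover have nonzero: "?G w \<noteq> 0" for w
      using b(1) F0_nonzero by (simp add: twist_section_def)
    moreover have "\<not> (AE w in lebesgue. ?G w = 0)"
    proof
      assume "AE w in lebesgue. ?G w = 0"
      with b(3) have "AE w in lebesgue. F w = 0" by eventually_elim simp
      then show False using F by (simp add: eigensection_def)
    qed
    ultimately have "eigensection U A \<tau> ?G \<eta> \<and> carried_by l ?G"
      using eigensection_carried_iff by blast
    then show ?thesis
      using explicit_twist_analytic [OF explicit] nonzero b(3) by blast
  qed
qed

end
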